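(* There exists an integer $d_0>0$ such that for every fixed integer $d\geq d_0$, if $G$ is the uniformly random $d$-regular graph on the vertex set $[n]$ (with $dn$ even), then with probability tending to $1$ as $n\to\infty$: (1) for every integer $k$ with $\frac{d}{2}+\sqrt{d}\leq k\leq d$, $r_\ell(G,\mathcal{K}^V_k)=d-k+1$; (2) for every integer $k$ with $1\leq k<\frac{d}{2}+\sqrt{d}$, $\frac{d}{2}-\sqrt{d}< r_\ell(G,\mathcal{K}^V_k)\leq\min\{d-k+1,\frac{d}{2}+4\sqrt{d\ln d}\}$.
   Context: For a monotone increasing graph property $\mathcal{P}$ and a graph $G$, the local resilience is $r_\ell(G,\mathcal{P})=\min\{r: \exists H\subseteq G \text{ with } \Delta(H)=r \text{ and } G- H\notin\mathcal{P}\}$, where $H\subseteq G$ is a subgraph on the same vertex set, $\Delta(H)$ its maximum degree, and $G-H$ the graph obtained by deleting the edges of $H$. $\mathcal{K}^V_k$ denotes the property of being $k$-vertex connected (removing any $k-1$ vertices leaves the graph connected). *)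

theory Defs
  imports "HOL-Probability.Probability"
begin

type_synonym 'a graph = "'a set \<times> 'a set set"

abbreviation verts :: "'a graph \<Rightarrow> 'a set" where "verts G \<equiv> fst G"
abbreviation edges :: "'a graph \<Rightarrow> 'a set set" where "edges G \<equiv> snd G"

definition simple_graph :: "'a graph \<Rightarrow> bool" where
  "simple_graph G \<longleftrightarrow> finite (verts G) \<and> (\<forall>e\<in>edges G. e \<subseteq> verts G \<and> card e = 2)"

definition vdegree :: "'a graph \<Rightarrow> 'a \<Rightarrow> nat" where
  "vdegree G v = card {e \<in> edges G. v \<in> e}"

definition max_degree :: "'a graph \<Rightarrow> nat" where
  "max_degree G = Max (vdegree G ` verts G)"

definition spanning_subgraph :: "'a graph \<Rightarrow> 'a graph \<Rightarrow> bool" where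
  "spanning_subgraph H G \<longleftrightarrow> verts H = verts G \<and> edges H \<subseteq> edges G"

definition delete_edges :: "'a graph \<Rightarrow> 'a graph \<Rightarrow> 'a graph" where
  "delete_edges G H = (verts G, edges G - edges H)"

definition delete_vertices :: "'a graph \<Rightarrow> 'a set \<Rightarrow> 'a graph" where
  "delete_vertices G S = (verts G - S, {e \<in> edges G. e \<inter> S = {}})"

definition connected_graph :: "'a graph \<Rightarrow> bool" where
  "connected_graph G \<longleftrightarrow> verts G \<noteq> {} \<and>
     (\<forall>u\<in>verts G. \<forall>v\<in>verts G. (\<lambda>x y. {x, y} \<in> edges G)\<^sup>*\<^sup>* u v)"

text \<open>Only the case \<open>1 \<le> k < card (verts G)\<close> is of interest; no separate convention is imposed
  for graphs with at most \<open>k\<close> vertices.\<close>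

definition vertex_connected :: "nat \<Rightarrow> 'a graph set" where
  "vertex_connected k =
     {G. \<forall>S. S \<subseteq> verts G \<and> card S = k - 1 \<longrightarrow> connected_graph (delete_vertices G S)}"

text \<open>The minimum is unspecified if no subgraph destroys the property;
  \<open>local_resilience_attained\<close> below excludes this for \<open>k\<close>-vertex connectivity.\<close>

definition local_resilience :: "'a graph \<Rightarrow> 'a graph set \<Rightarrow> nat" where
  "local_resilience G P =
     (LEAST r. \<exists>H. spanning_subgraph H G \<and> max_degree H = r \<and> delete_edges G H \<notin> P)"

definition regular_graphs :: "nat \<Rightarrow> nat \<Rightarrow> nat graph set" where
  "regular_graphs n d =
     {G. verts G = {1..n} \<and> simple_graph G \<and> (\<forall>v\<in>verts G. vdegree G v = d)}"

text \<open>Meaningful only where \<open>regular_graphs n d\<close> is nonempty, that is, if \<open>d * n\<close> is even and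
  \<open>d < n\<close> (or \<open>n = 0\<close>).\<close>

definition random_regular_graph :: "nat \<Rightarrow> nat \<Rightarrow> nat graph pmf" where
  "random_regular_graph n d = pmf_of_set (regular_graphs n d)"

lemma finite_regular_graphs: "finite (regular_graphs n d)"
proof (rule finite_subset)
  show "regular_graphs n d \<subseteq> {{1..n}} \<times> Pow (Pow {1..n})"
    unfolding regular_graphs_def simple_graph_def by fastforce
qed simp

lemma vertex_connected_mono:
  assumes "G \<in> vertex_connected k" "verts G' = verts G" "edges G \<subseteq> edges G'"
  shows "G' \<in> vertex_connected k"
proof -
  have "connected_graph (delete_vertices G' S)"
    if "connected_graph (delete_vertices G S)" for S
  proof -
    have "(\<lambda>x y. {x, y} \<in> edges (delete_vertices G S))\<^sup>*\<^sup>* \<le>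
          (\<lambda>x y. {x, y} \<in> edges (delete_vertices G' S))\<^sup>*\<^sup>*"
      by (rule rtranclp_mono) (use assms(3) in \<open>auto simp: delete_vertices_def\<close>)
    then show ?thesis
      using that assms(2) by (auto simp: connected_graph_def delete_vertices_def)
  qed
  then show ?thesis
    using assms by (auto simp: vertex_connected_def)
qed

lemma local_resilience_attained:
  assumes "1 \<le> k" "k < card (verts G)"
  shows "\<exists>H. spanning_subgraph H G \<and> max_degree H = local_resilience G (vertex_connected k) \<and>
             delete_edges G H \<notin> vertex_connected k"
proof -
  have fin: "finite (verts G)"
    using assms(2) by (metis card.infinite not_less_zero)
  obtain S where S: "S \<subseteq> verts G" "card S = k - 1"
  proof (rule obtain_subset_with_card_n)
    show "k - 1 \<le> card (verts G)" using assms by simp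
  qed
  have "card (verts G - S) = card (verts G) - (k - 1)"
    using S fin by (simp add: card_Diff_subset finite_subset)
  then have "\<not> card (verts G - S) \<le> Suc 0"
    using assms by simp
  then obtain u v where uv: "u \<in> verts G - S" "v \<in> verts G - S" "u \<noteq> v"
    using fin by (auto simp: card_le_Suc0_iff_eq)
  have "\<not> (\<lambda>x y. False)\<^sup>*\<^sup>* u v"
    using uv(3) by (auto elim: converse_rtranclpE)
  then have "\<not> connected_graph (delete_vertices (delete_edges G G) S)"
    using uv unfolding connected_graph_def delete_vertices_def delete_edges_def by fastforce
  then have "delete_edges G G \<notin> vertex_connected k"
    using S by (auto simp: vertex_connected_def delete_edges_def)
  then have "\<exists>r H. spanning_subgraph H G \<and> max_degree H = r \<and>
      delete_edges G H \<notin> vertex_connected k"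
    by (auto simp: spanning_subgraph_def)
  then show ?thesis
    unfolding local_resilience_def by (rule LeastI_ex)
qed

end

theory Submission
  imports Defs
begin

text \<open>Upper bounds: deleting \<open>d - k + 1\<close> edges at one vertex leaves it with \<open>k - 1\<close> neighbours,
  and by Stiebitz's theorem every \<open>d\<close>-regular graph has a vertex partition in which each vertex has
  at most \<open>d / 2 + 1\<close> neighbours on the other side.

  Lower bounds: suppose that deleting \<open>H\<close> and \<open>k - 1\<close> vertices \<open>S\<close> separates a set \<open>A\<close> of at most
  \<open>n / 2\<close> vertices, where \<open>\<Delta>(H) \<le> min (d - k) (d / 2 - sqrt d)\<close>. Then each vertex of \<open>A\<close> has at least
  \<open>max k (d / 2 + sqrt d)\<close> neighbours in \<open>A \<union> S\<close>. If \<open>A\<close> has bounded size, then \<open>A \<union> S\<close> spans too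
  many edges for a bounded set; otherwise \<open>S\<close> is negligible and \<open>A\<close> itself is too dense. Both are
  excluded by a first-moment argument. Replacing an edge \<open>uv\<close> inside \<open>A\<close> and an edge \<open>xy\<close> outside
  \<open>A\<close> by \<open>ux\<close> and \<open>vy\<close> compares the numbers of \<open>d\<close>-regular graphs with \<open>t + 2\<close> and with \<open>t\<close> ordered
  adjacent pairs in \<open>A\<close> directly, without the configuration model. For \<open>a = |A|\<close> the product of these
  ratios is at most a constant times \<open>(a / (n - a)) ^ (2 * a) * exp (- 7 / 4 * a)\<close>, which beats the
  number \<open>(e * n / a) ^ a\<close> of sets because \<open>2 * exp (- 3 / 4) < 1\<close>.\<close>

section \<open>Neighbourhoods and separations\<close>

definition nbrs :: "'a set set \<Rightarrow> 'a \<Rightarrow> 'a set \<Rightarrow> 'a set" where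
  "nbrs E v X = {w \<in> X. {v, w} \<in> E}"

text \<open>Ordered pairs: the edges inside \<open>A\<close> are counted twice by \<open>arcs E A A\<close>.\<close>

definition arcs :: "'a set set \<Rightarrow> 'a set \<Rightarrow> 'a set \<Rightarrow> ('a \<times> 'a) set" where
  "arcs E A B = (SIGMA v:A. nbrs E v B)"

lemma nbrs_subset: "nbrs E v X \<subseteq> X"
  by (auto simp: nbrs_def)

lemma finite_nbrs [simp]: "finite X \<Longrightarrow> finite (nbrs E v X)"
  by (simp add: nbrs_def)

lemma mem_arcs: "(u, v) \<in> arcs E A B \<longleftrightarrow> u \<in> A \<and> v \<in> B \<and> {u, v} \<in> E"
  by (auto simp: arcs_def nbrs_def)

lemma finite_arcs [simp]: "finite A \<Longrightarrow> finite B \<Longrightarrow> finite (arcs E A B)"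
  by (simp add: arcs_def)

lemma card_arcs:
  assumes "finite A" "finite B"
  shows "card (arcs E A B) = (\<Sum>v\<in>A. card (nbrs E v B))"
  using assms by (simp add: arcs_def)

lemma card_arcs_commute: "card (arcs E A B) = card (arcs E B A)"
proof -
  have "arcs E B A = prod.swap ` arcs E A B"
  proof (intro set_eqI iffI)
    fix p assume "p \<in> arcs E B A"
    then have "prod.swap p \<in> arcs E A B" by (cases p) (simp add: mem_arcs insert_commute)
    then have "prod.swap (prod.swap p) \<in> prod.swap ` arcs E A B" by (rule imageI)
    then show "p \<in> prod.swap ` arcs E A B" by simp
  next
    fix p assume "p \<in> prod.swap ` arcs E A B"
    then show "p \<in> arcs E B A" by (auto simp: mem_arcs insert_commute)
  qed
  then show ?thesis
    by (simp add: card_image)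
qed

lemma card_nbrs_mono: "X \<subseteq> Y \<Longrightarrow> finite Y \<Longrightarrow> card (nbrs E v X) \<le> card (nbrs E v Y)"
  by (rule card_mono) (auto simp: nbrs_def)

lemma card_nbrs_Un:
  assumes "finite X" "finite Y" "X \<inter> Y = {}"
  shows "card (nbrs E v (X \<union> Y)) = card (nbrs E v X) + card (nbrs E v Y)"
proof -
  have "nbrs E v (X \<union> Y) = nbrs E v X \<union> nbrs E v Y" "nbrs E v X \<inter> nbrs E v Y = {}"
    using assms(3) by (auto simp: nbrs_def)
  then show ?thesis
    using assms by (simp add: card_Un_disjoint)
qed

lemma card_arcs_Un_right:
  assumes "finite A" "finite X" "finite Y" "X \<inter> Y = {}"
  shows "card (arcs E A (X \<union> Y)) = card (arcs E A X) + card (arcs E A Y)"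
  using assms by (simp add: card_arcs card_nbrs_Un sum.distrib)

lemma card_arcs_Un_left:
  assumes "finite A" "finite X" "finite Y" "X \<inter> Y = {}"
  shows "card (arcs E (X \<union> Y) A) = card (arcs E X A) + card (arcs E Y A)"
  using card_arcs_Un_right[OF assms] by (simp add: card_arcs_commute)

text \<open>Every edge between \<open>A\<close> and \<open>S\<close> contributes two ordered pairs
  inside \<open>A \<union> S\<close>; the pairs inside \<open>S\<close> are discarded.\<close>

lemma card_arcs_self_Un:
  assumes "finite A" "finite S" "A \<inter> S = {}"
  shows "card (arcs E A A) + 2 * card (arcs E A S) \<le> card (arcs E (A \<union> S) (A \<union> S))"
  using assms by (simp add: card_arcs_Un_right card_arcs_Un_left card_arcs_commute[of E S A])

section \<open>Degrees in simple graphs\<close>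

lemma simple_graph_no_loop: "simple_graph G \<Longrightarrow> {v} \<notin> edges G"
  by (auto simp: simple_graph_def)

lemma vdegree_eq_card_nbrs:
  assumes "simple_graph G"
  shows "vdegree G v = card (nbrs (edges G) v (verts G))"
proof -
  have "{e \<in> edges G. v \<in> e} = (\<lambda>w. {v, w}) ` nbrs (edges G) v (verts G)"
  proof (intro set_eqI iffI)
    fix e assume e: "e \<in> {e \<in> edges G. v \<in> e}"
    then have "card e = 2" "e \<subseteq> verts G"
      using assms by (auto simp: simple_graph_def)
    then obtain a b where "e = {a, b}" by (auto simp: card_2_iff)
    with e \<open>e \<subseteq> verts G\<close> obtain w where "e = {v, w}" "w \<in> verts G"
      by (cases "a = v") (auto simp: insert_commute)
    with e show "e \<in> (\<lambda>w. {v, w}) ` nbrs (edges G) v (verts G)"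
      by (auto simp: nbrs_def)
  qed (auto simp: nbrs_def)
  moreover have "inj_on (\<lambda>w. {v, w}) X" for X
    by (auto simp: inj_on_def doubleton_eq_iff)
  ultimately show ?thesis
    by (simp add: vdegree_def card_image)
qed

lemma simple_graph_subgraph:
  "simple_graph G \<Longrightarrow> spanning_subgraph H G \<Longrightarrow> simple_graph H"
  by (auto simp: simple_graph_def spanning_subgraph_def)

lemma vdegree_le_max_degree:
  "simple_graph G \<Longrightarrow> v \<in> verts G \<Longrightarrow> vdegree G v \<le> max_degree G"
  by (auto simp: simple_graph_def max_degree_def)

section \<open>Separations and local resilience\<close>

lemma rtranclp_closed:
  assumes "R\<^sup>*\<^sup>* x y" "x \<in> C" "\<And>x y. x \<in> C \<Longrightarrow> R x y \<Longrightarrow> y \<in> C"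
  shows "y \<in> C"
  using assms(1,2) by induction (auto intro: assms(3))

text \<open>The edges between \<open>A\<close> and \<open>B\<close> form a witness of maximum degree
  at most \<open>c\<close>: once they and \<open>S\<close> are deleted, no path leads out of
  \<open>A\<close>.\<close>

lemma local_resilience_le_of_separation:
  assumes G: "simple_graph G" and V: "verts G = A \<union> B \<union> S"
    and disj: "A \<inter> B = {}" "A \<inter> S = {}" "B \<inter> S = {}" and ne: "A \<noteq> {}" "B \<noteq> {}"
    and S: "card S = k - 1"
    and degA: "\<And>v. v \<in> A \<Longrightarrow> card (nbrs (edges G) v B) \<le> c"
    and degB: "\<And>v. v \<in> B \<Longrightarrow> card (nbrs (edges G) v A) \<le> c"
  shows "local_resilience G (vertex_connected k) \<le> c"
proof -
  define H where "H = (verts G, {e \<in> edges G. e \<inter> A \<noteq> {} \<and> e \<inter> B \<noteq> {}})"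
  have H: "spanning_subgraph H G"
    by (auto simp: H_def spanning_subgraph_def)
  have fin: "finite (verts G)" using G by (simp add: simple_graph_def)
  then have finAB: "finite A" "finite B" unfolding V by simp_all
  have "vdegree H v \<le> c" if "v \<in> verts G" for v
  proof -
    have *: "vdegree H v = card (nbrs (edges H) v (verts H))"
      using simple_graph_subgraph[OF G H] by (rule vdegree_eq_card_nbrs)
    have "v \<in> A \<union> B \<union> S" using that V by simp
    then consider "v \<in> A" | "v \<in> B" | "v \<in> S" by blast
    then show ?thesis
    proof cases
      case 1
      have "nbrs (edges H) v (verts H) \<subseteq> nbrs (edges G) v B"
      proof
        fix w assume "w \<in> nbrs (edges H) v (verts H)"
        then have "{v, w} \<in> edges G" "{v, w} \<inter> B \<noteq> {}" by (simp_all add: nbrs_def H_def)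
        with 1 disj(1) show "w \<in> nbrs (edges G) v B" by (auto simp: nbrs_def)
      qed
      then have "vdegree H v \<le> card (nbrs (edges G) v B)"
        unfolding * using finAB by (intro card_mono) auto
      also have "\<dots> \<le> c" using degA[OF 1] .
      finally show ?thesis .
    next
      case 2
      have "nbrs (edges H) v (verts H) \<subseteq> nbrs (edges G) v A"
      proof
        fix w assume "w \<in> nbrs (edges H) v (verts H)"
        then have "{v, w} \<in> edges G" "{v, w} \<inter> A \<noteq> {}" by (simp_all add: nbrs_def H_def)
        with 2 disj(1) show "w \<in> nbrs (edges G) v A" by (auto simp: nbrs_def)
      qed
      then have "vdegree H v \<le> card (nbrs (edges G) v A)"
        unfolding * using finAB by (intro card_mono) auto
      also have "\<dots> \<le> c" using degB[OF 2] .
      finally show ?thesis .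
    next
      case 3
      have "w \<notin> nbrs (edges H) v (verts H)" for w
      proof
        assume "w \<in> nbrs (edges H) v (verts H)"
        then have "{v, w} \<inter> A \<noteq> {}" "{v, w} \<inter> B \<noteq> {}" by (simp_all add: nbrs_def H_def)
        with 3 disj show False by blast
      qed
      then have "nbrs (edges H) v (verts H) = {}" by blast
      then show ?thesis using * by simp
    qed
  qed
  then have "max_degree H \<le> c"
    using fin ne V by (simp add: max_degree_def H_def)
  moreover have "delete_edges G H \<notin> vertex_connected k"
  proof
    assume "delete_edges G H \<in> vertex_connected k"
    then have conn: "connected_graph (delete_vertices (delete_edges G H) S)"
      using S V by (auto simp: vertex_connected_def delete_edges_def)
    obtain a b where ab: "a \<in> A" "b \<in> B" using ne by auto
    let ?R = "\<lambda>x y. {x, y} \<in> edges (delete_vertices (delete_edges G H) S)"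
    have "a \<in> verts G - S" "b \<in> verts G - S" using ab V disj by blast+
    with conn have "?R\<^sup>*\<^sup>* a b"
      by (simp add: connected_graph_def delete_vertices_def delete_edges_def)
    then have "b \<in> A"
    proof (rule rtranclp_closed)
      fix x y assume x: "x \<in> A" and "?R x y"
      then have e: "{x, y} \<in> edges G" "{x, y} \<notin> edges H" "y \<notin> S"
        by (simp_all add: delete_vertices_def delete_edges_def)
      then have "y \<in> verts G" using G by (auto simp: simple_graph_def)
      moreover have "y \<notin> B" using e x by (auto simp: H_def)
      ultimately show "y \<in> A" using V e(3) by blast
    qed (use ab in auto)
    with ab disj show False by auto
  qed
  ultimately show ?thesis
    unfolding local_resilience_def using H
    by (intro order_trans[OF Least_le[of _ "max_degree H"]] exI[of _ H]) auto
qed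

text \<open>Conversely, a component of what remains after both deletions and the rest of the
  remaining vertices give two sides with no remaining edge between them. The smaller side is
  \<open>A\<close>; all edges of \<open>G\<close> from \<open>A\<close> to the other side lie in
  \<open>H\<close>, so a vertex of \<open>A\<close> has at most \<open>max_degree H\<close>
  neighbours outside \<open>A \<union> S\<close>.\<close>

lemma separation_of_not_vertex_connected:
  assumes G: "simple_graph G" and H: "spanning_subgraph H G"
    and reg: "\<And>v. v \<in> verts G \<Longrightarrow> vdegree G v = d"
    and k: "1 \<le> k" "k \<le> card (verts G)"
    and nc: "delete_edges G H \<notin> vertex_connected k"
  obtains A S where "A \<noteq> {}" "A \<subseteq> verts G" "S \<subseteq> verts G" "A \<inter> S = {}" "card S = k - 1"
    "2 * card A \<le> card (verts G)"
    "\<And>v. v \<in> A \<Longrightarrow> d \<le> card (nbrs (edges G) v (A \<union> S)) + max_degree H"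
proof -
  note result = that
  have fin: "finite (verts G)" using G by (simp add: simple_graph_def)
  obtain S where S: "S \<subseteq> verts G" "card S = k - 1"
      and ncS: "\<not> connected_graph (delete_vertices (delete_edges G H) S)"
    using nc by (auto simp: vertex_connected_def delete_edges_def)
  define E' where "E' = edges (delete_vertices (delete_edges G H) S)"
  let ?R = "\<lambda>x y. {x, y} \<in> E'"
  have "verts G \<noteq> S" using S k by auto
  then obtain u v where uv: "u \<in> verts G - S" "v \<in> verts G - S" "\<not> ?R\<^sup>*\<^sup>* u v"
    using ncS S by (auto simp: connected_graph_def E'_def delete_vertices_def delete_edges_def)
  define C where "C = {w \<in> verts G - S. ?R\<^sup>*\<^sup>* u w}"
  define D where "D = verts G - S - C"
  have CD: "C \<union> D = verts G - S" "C \<inter> D = {}" "u \<in> C" "v \<in> D"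
    using uv by (auto simp: C_def D_def)
  have closed: "{x, y} \<notin> E'" if "x \<in> C" "y \<in> D" for x y
  proof
    assume "{x, y} \<in> E'"
    with that(1) have "?R\<^sup>*\<^sup>* u y" by (auto simp: C_def intro: rtranclp.rtrancl_into_rtrancl)
    with that(2) show False by (auto simp: C_def D_def)
  qed
  \<comment> \<open>Stated for an arbitrary pair of sides, so that the cardinalities decide whether
    \<open>C\<close> or \<open>D\<close> becomes \<open>A\<close>.\<close>
  have main: thesis if AB: "A \<union> B = verts G - S" "A \<inter> B = {}" "A \<noteq> {}" "card A \<le> card B"
      and cl: "\<And>x y. x \<in> A \<Longrightarrow> y \<in> B \<Longrightarrow> {x, y} \<notin> E'" for A B
  proof (rule result)
    show "A \<noteq> {}" "A \<subseteq> verts G" "S \<subseteq> verts G" "A \<inter> S = {}" "card S = k - 1"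
      using AB S by auto
    have finA: "finite A" "finite B" "finite S"
      using AB(1) fin S(1) by (metis finite_Diff finite_Un, metis finite_Diff finite_Un, metis finite_subset)
    have "card A + card B = card (verts G - S)"
      using AB finA by (metis card_Un_disjoint)
    also have "\<dots> \<le> card (verts G)" using fin by (simp add: card_mono)
    finally show "2 * card A \<le> card (verts G)" using AB(4) by simp
    fix x assume x: "x \<in> A"
    have "d = card (nbrs (edges G) x (verts G))"
      using reg[of x] x AB G vdegree_eq_card_nbrs by (metis DiffD1 UnI1)
    also have "verts G = (A \<union> S) \<union> B" using AB S by auto
    also have "card (nbrs (edges G) x \<dots>) = card (nbrs (edges G) x (A \<union> S)) + card (nbrs (edges G) x B)"
      by (rule card_nbrs_Un) (use finA AB in auto)
    \<comment> \<open>Such an edge of \<open>G\<close> avoids \<open>S\<close> and is absent from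
      \<open>E'\<close>, so it was deleted with \<open>H\<close>.\<close>
    also have "card (nbrs (edges G) x B) \<le> card (nbrs (edges H) x (verts H))"
    proof (rule card_mono)
      show "finite (nbrs (edges H) x (verts H))"
        using H fin by (simp add: spanning_subgraph_def)
      show "nbrs (edges G) x B \<subseteq> nbrs (edges H) x (verts H)"
      proof
        fix y assume y: "y \<in> nbrs (edges G) x B"
        then have "{x, y} \<notin> E'" using cl x by (auto simp: nbrs_def)
        moreover have "x \<notin> S" "y \<notin> S" "y \<in> verts G" using x y AB by (auto simp: nbrs_def)
        ultimately show "y \<in> nbrs (edges H) x (verts H)"
          using y H by (auto simp: E'_def delete_vertices_def delete_edges_def nbrs_def spanning_subgraph_def)
      qed
    qed
    also have "\<dots> = vdegree H x"
      using simple_graph_subgraph[OF G H] by (simp add: vdegree_eq_card_nbrs)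
    also have "\<dots> \<le> max_degree H"
      using simple_graph_subgraph[OF G H] x AB H
      by (intro vdegree_le_max_degree) (auto simp: spanning_subgraph_def)
    finally show "d \<le> card (nbrs (edges G) x (A \<union> S)) + max_degree H" by simp
  qed
  show thesis
  proof (cases "card C \<le> card D")
    case True
    then show ?thesis using main[of C D] CD closed by auto
  next
    case False
    have "{y, x} \<notin> E'" if "y \<in> D" "x \<in> C" for x y
      using closed[OF that(2,1)] by (simp add: insert_commute)
    then show ?thesis using main[of D C] CD False by (auto simp: Int_commute Un_commute)
  qed
qed

section \<open>Partitions with large inner degrees\<close>

definition inner_degree_ge :: "'a set set \<Rightarrow> nat \<Rightarrow> 'a set \<Rightarrow> bool" where
  "inner_degree_ge E s X \<longleftrightarrow> X \<noteq> {} \<and> (\<forall>v\<in>X. s \<le> card (nbrs E v X))"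

text \<open>Ordinary \<open>s\<close>-degeneracy of the induced subgraph: each nonempty subset has a
  vertex with at most \<open>s\<close> neighbours in it.\<close>

definition degenerate :: "'a set set \<Rightarrow> nat \<Rightarrow> 'a set \<Rightarrow> bool" where
  "degenerate E s X \<longleftrightarrow> (\<forall>Y\<subseteq>X. \<not> inner_degree_ge E (Suc s) Y)"

lemma degenerate_subset: "degenerate E s X \<Longrightarrow> Y \<subseteq> X \<Longrightarrow> degenerate E s Y"
  by (auto simp: degenerate_def)

lemma degenerate_vertex:
  assumes "degenerate E s X" "X \<noteq> {}"
  obtains v where "v \<in> X" "card (nbrs E v X) \<le> s"
  using assms unfolding degenerate_def inner_degree_ge_def
  by (metis not_less_eq_eq order_refl)

text \<open>Every other vertex loses at most one neighbour, and something is left because a single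
  vertex without a loop has inner degree 0.\<close>

lemma inner_degree_ge_remove:
  assumes "inner_degree_ge E (Suc s) X" "finite X" "\<And>v. {v} \<notin> E"
  shows "inner_degree_ge E s (X - {x})"
proof -
  have "s \<le> card (nbrs E v (X - {x}))" if "v \<in> X" for v
  proof -
    have "nbrs E v (X - {x}) = nbrs E v X - {x}" by (auto simp: nbrs_def)
    then have "card (nbrs E v X) - 1 \<le> card (nbrs E v (X - {x}))"
      using diff_card_le_card_Diff[of "{x}" "nbrs E v X"] by simp
    moreover have "Suc s \<le> card (nbrs E v X)"
      using that assms(1) by (auto simp: inner_degree_ge_def)
    ultimately show ?thesis by linarith
  qed
  moreover have "X - {x} \<noteq> {}"
  proof
    assume "X - {x} = {}"
    then have "X = {x}" using assms(1) by (auto simp: inner_degree_ge_def)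
    then have "nbrs E x X = {}" using assms(3)[of x] by (auto simp: nbrs_def)
    with assms(1) \<open>X = {x}\<close> show False by (auto simp: inner_degree_ge_def)
  qed
  ultimately show ?thesis by (auto simp: inner_degree_ge_def)
qed

context
  fixes V :: "'a set" and E :: "'a set set" and s :: nat
  assumes fin: "finite V" and no_loop: "\<And>v. {v} \<notin> E" and s: "1 \<le> s"
    and deg: "\<And>v. v \<in> V \<Longrightarrow> 2 * s + 1 \<le> card (nbrs E v V)"
begin

definition degenerate_cuts :: "'a set set" where
  "degenerate_cuts = {A. A \<subseteq> V \<and> A \<noteq> {} \<and> V - A \<noteq> {} \<and> degenerate E s A \<and> degenerate E s (V - A)}"

lemma card_nbrs_split:
  assumes "A \<subseteq> V" shows "card (nbrs E v V) = card (nbrs E v A) + card (nbrs E v (V - A))"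
proof -
  have "finite A" using assms fin by (rule finite_subset)
  then show ?thesis
    using card_nbrs_Un[of A "V - A" E v] assms fin by (simp add: Un_absorb1)
qed

lemma degenerate_cut_low_vertex:
  assumes "A \<in> degenerate_cuts"
  obtains x where "x \<in> A" "card (nbrs E x A) \<le> s" "s + 1 \<le> card (nbrs E x (V - A))"
proof -
  have A: "A \<subseteq> V" "A \<noteq> {}" "degenerate E s A" using assms by (auto simp: degenerate_cuts_def)
  then obtain x where x: "x \<in> A" "card (nbrs E x A) \<le> s" using degenerate_vertex by metis
  then have "s + 1 \<le> card (nbrs E x (V - A))"
    using deg[of x] card_nbrs_split[OF A(1), of x] A(1) by auto
  with x show ?thesis by (rule that)
qed

text \<open>Moving a vertex of low inner degree across a minimal cut makes the cut smaller, so the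
  enlarged side cannot be degenerate any more.\<close>

lemma minimal_degenerate_cut_enlarge:
  assumes A: "A \<in> degenerate_cuts"
    and min: "\<And>A'. A' \<in> degenerate_cuts \<Longrightarrow> card (arcs E A (V - A)) \<le> card (arcs E A' (V - A'))"
  obtains x B' where "x \<in> A" "B' \<subseteq> insert x (V - A)" "inner_degree_ge E (Suc s) B'"
proof -
  obtain x where x: "x \<in> A" "card (nbrs E x A) \<le> s" "s + 1 \<le> card (nbrs E x (V - A))"
    using degenerate_cut_low_vertex[OF A] by metis
  have AV: "A \<subseteq> V" using A by (simp add: degenerate_cuts_def)
  have finA: "finite A" using AV fin by (rule finite_subset)
  have V: "V - (A - {x}) = insert x (V - A)" using AV x by auto
  have "V - A \<in> degenerate_cuts"
    using A by (auto simp: degenerate_cuts_def double_diff)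
  then obtain y where y: "y \<in> V - A" "s + 1 \<le> card (nbrs E y (V - (V - A)))"
    using degenerate_cut_low_vertex by metis
  \<comment> \<open>With \<open>1 \<le> s\<close>, the low vertex \<open>y\<close> of the other side
    has two neighbours in \<open>A\<close>; hence removing \<open>x\<close> does not empty
    \<open>A\<close>.\<close>
  then have "2 \<le> card (nbrs E y A)" using s AV by (simp add: double_diff)
  also have "\<dots> \<le> card A" using finA by (intro card_mono nbrs_subset)
  finally have "card (A - {x}) \<noteq> 0" using x finA by simp
  then have ne: "A - {x} \<noteq> {}" by (metis card.empty)
  have "card (arcs E (A - {x}) (insert x (V - A))) < card (arcs E A (V - A))"
  proof -
    have "A = {x} \<union> (A - {x})" using x by auto
    then have 1: "card (arcs E A (V - A)) = card (nbrs E x (V - A)) + card (arcs E (A - {x}) (V - A))"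
      using card_arcs_Un_left[of "V - A" "{x}" "A - {x}" E] fin finA by (simp add: card_arcs)
    have "card (arcs E (A - {x}) ((V - A) \<union> {x})) =
        card (arcs E (A - {x}) (V - A)) + card (arcs E (A - {x}) {x})"
      by (rule card_arcs_Un_right) (use fin finA x in auto)
    also have "card (arcs E (A - {x}) {x}) = card (nbrs E x (A - {x}))"
      using finA by (subst card_arcs_commute) (simp add: card_arcs)
    also have "\<dots> \<le> card (nbrs E x A)" using finA by (intro card_nbrs_mono) auto
    also have "(V - A) \<union> {x} = insert x (V - A)" by auto
    finally show ?thesis using 1 x by linarith
  qed
  then have "A - {x} \<notin> degenerate_cuts" using min[of "A - {x}"] V by fastforce
  then have "\<not> degenerate E s (insert x (V - A))"
    using A ne V degenerate_subset[of E s A "A - {x}"] by (auto simp: degenerate_cuts_def)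
  then obtain B' where "B' \<subseteq> insert x (V - A)" "inner_degree_ge E (Suc s) B'"
    unfolding degenerate_def by blast
  with x(1) show ?thesis by (rule that)
qed

text \<open>If no such pair existed, a smallest set of inner degree at least \<open>s\<close> and
  its complement would form a degenerate cut. In a degenerate cut with fewest crossing edges both
  sides can be enlarged by one vertex so as to contain sets of inner degree at least
  \<open>s + 1\<close>, and these yield a disjoint pair after all.\<close>

lemma disjoint_inner_degree_ge:
  assumes "V \<noteq> {}"
  obtains A B where "A \<subseteq> V" "B \<subseteq> V" "A \<inter> B = {}" "inner_degree_ge E s A" "inner_degree_ge E s B"
proof (rule ccontr)
  note result = that
  assume "\<not> thesis"
  then have no: False if "A \<subseteq> V" "B \<subseteq> V" "A \<inter> B = {}" "inner_degree_ge E s A" "inner_degree_ge E s B" for A B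
    using result[OF that] by blast
  have V: "inner_degree_ge E (Suc s) V"
    unfolding inner_degree_ge_def
  proof (intro conjI ballI)
    fix v assume "v \<in> V"
    then show "Suc s \<le> card (nbrs E v V)" using deg[of v] by linarith
  qed (rule assms)
  then have "inner_degree_ge E s V" by (auto simp: inner_degree_ge_def)
  then have "\<exists>A. (A \<subseteq> V \<and> inner_degree_ge E s A) \<and>
      (\<forall>A'. A' \<subseteq> V \<and> inner_degree_ge E s A' \<longrightarrow> card A \<le> card A')"
    by (intro ex_has_least_nat[of _ V]) auto
  then obtain A where A: "A \<subseteq> V" "inner_degree_ge E s A"
    and Amin: "\<And>A'. A' \<subseteq> V \<Longrightarrow> inner_degree_ge E s A' \<Longrightarrow> card A \<le> card A'" by auto
  have finA: "finite A" using A fin finite_subset by auto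
  \<comment> \<open>A subset of inner degree at least \<open>s + 1\<close> could lose a vertex,
    giving a smaller set of inner degree at least \<open>s\<close>.\<close>
  have dA: "degenerate E s A" unfolding degenerate_def
  proof (intro allI impI notI)
    fix Y assume Y: "Y \<subseteq> A" "inner_degree_ge E (Suc s) Y"
    then obtain y where y: "y \<in> Y" by (auto simp: inner_degree_ge_def)
    have "finite Y" using Y finA finite_subset by auto
    with Y no_loop have "inner_degree_ge E s (Y - {y})" by (intro inner_degree_ge_remove)
    then have "card A \<le> card (Y - {y})" using Y A by (intro Amin) auto
    also have "\<dots> < card A"
      using Y y finA by (intro psubset_card_mono) auto
    finally show False by simp
  qed
  have "degenerate E s (V - A)" unfolding degenerate_def
  proof (intro allI impI notI)
    fix Y assume Y: "Y \<subseteq> V - A" "inner_degree_ge E (Suc s) Y"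
    then have "inner_degree_ge E s Y" by (auto simp: inner_degree_ge_def)
    with Y A show False by (intro no[of A Y]) auto
  qed
  moreover have "V - A \<noteq> {}"
    using V dA A unfolding degenerate_def by auto
  ultimately have "A \<in> degenerate_cuts"
    using A dA by (auto simp: degenerate_cuts_def inner_degree_ge_def)
  then have "\<exists>A. A \<in> degenerate_cuts \<and>
      (\<forall>A'. A' \<in> degenerate_cuts \<longrightarrow> card (arcs E A (V - A)) \<le> card (arcs E A' (V - A')))"
    by (rule ex_has_least_nat)
  then obtain A where A: "A \<in> degenerate_cuts"
    and min: "\<And>A'. A' \<in> degenerate_cuts \<Longrightarrow> card (arcs E A (V - A)) \<le> card (arcs E A' (V - A'))"
    by auto
  have AV: "A \<subseteq> V" using A by (simp add: degenerate_cuts_def)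
  then have VA: "V - (V - A) = A" by auto
  have "V - A \<in> degenerate_cuts" using A VA by (auto simp: degenerate_cuts_def)
  moreover have "card (arcs E (V - A) (V - (V - A))) \<le> card (arcs E A' (V - A'))"
    if "A' \<in> degenerate_cuts" for A'
    using min[OF that] card_arcs_commute VA by metis
  ultimately obtain y A' where y: "y \<in> V - A" "A' \<subseteq> insert y A" "inner_degree_ge E (Suc s) A'"
    using minimal_degenerate_cut_enlarge[of "V - A"] VA by metis
  obtain x B' where x: "x \<in> A" "B' \<subseteq> insert x (V - A)" "inner_degree_ge E (Suc s) B'"
    using minimal_degenerate_cut_enlarge[OF A min] by metis
  have "A' \<subseteq> V" "B' \<subseteq> V" using x y AV by auto
  then have "finite A'" "finite B'" using fin finite_subset by auto
  \<comment> \<open>\<open>A'\<close> and \<open>B'\<close> can meet only in the two moved vertices;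
    dropping one from each makes them disjoint and costs one unit of inner degree.\<close>
  then have "inner_degree_ge E s (A' - {x})" "inner_degree_ge E s (B' - {y})"
    using x y no_loop by (auto intro: inner_degree_ge_remove)
  then show False
    using x y AV by (intro no[of "A' - {x}" "B' - {y}"]) auto
qed

text \<open>The symmetric case of Stiebitz's theorem. Among disjoint pairs of inner degree at least
  \<open>s\<close>, take one with the largest union. If a vertex is missed, then some
  \<open>x\<close> outside \<open>B\<close> has fewer than \<open>s\<close> neighbours outside
  \<open>B\<close>; it is not in \<open>A\<close>, it has more than \<open>s\<close> neighbours in
  \<open>B\<close>, and adding it to \<open>B\<close> enlarges the union.\<close>

lemma Stiebitz_partition:
  assumes "V \<noteq> {}"
  obtains A B where "A \<union> B = V" "A \<inter> B = {}" "inner_degree_ge E s A" "inner_degree_ge E s B"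
proof -
  define P where "P = {(A, B). A \<subseteq> V \<and> B \<subseteq> V \<and> A \<inter> B = {} \<and> inner_degree_ge E s A \<and> inner_degree_ge E s B}"
  obtain A0 B0 where "A0 \<subseteq> V" "B0 \<subseteq> V" "A0 \<inter> B0 = {}" "inner_degree_ge E s A0" "inner_degree_ge E s B0"
    using disjoint_inner_degree_ge[OF assms] .
  then have "(A0, B0) \<in> P" by (simp add: P_def)
  moreover have "\<forall>p. p \<in> P \<longrightarrow> card (fst p \<union> snd p) < Suc (card V)"
    using fin by (auto simp: P_def intro!: card_mono le_imp_less_Suc)
  ultimately have "\<exists>p. p \<in> P \<and> (\<forall>q. q \<in> P \<longrightarrow> card (fst q \<union> snd q) \<le> card (fst p \<union> snd p))"
    by (rule ex_has_greatest_nat)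
  then obtain A B where AB: "(A, B) \<in> P"
    and max: "\<And>A' B'. (A', B') \<in> P \<Longrightarrow> card (A' \<union> B') \<le> card (A \<union> B)"
    by (auto split: prod.splits)
  have sub: "A \<subseteq> V" "B \<subseteq> V" "A \<inter> B = {}" and gA: "inner_degree_ge E s A" and gB: "inner_degree_ge E s B"
    using AB by (auto simp: P_def)
  have finAB: "finite A" "finite B" using sub fin by (meson finite_subset)+
  have "A \<union> B = V"
  proof (rule ccontr)
    assume "A \<union> B \<noteq> V"
    then have psub: "A \<union> B \<subset> V" using sub by auto
    have "(V - B, B) \<notin> P"
    proof
      assume "(V - B, B) \<in> P"
      then have "card (V - B \<union> B) \<le> card (A \<union> B)" by (rule max)
      also have "\<dots> < card V" using psub fin by (simp add: psubset_card_mono)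
      finally show False using sub by (simp add: Un_absorb2)
    qed
    then obtain x where x: "x \<in> V - B" "card (nbrs E x (V - B)) < s"
      using sub gB gA by (auto simp: P_def inner_degree_ge_def not_le)
    have "x \<notin> A"
    proof
      assume "x \<in> A"
      then have "s \<le> card (nbrs E x A)" using gA by (auto simp: inner_degree_ge_def)
      also have "\<dots> \<le> card (nbrs E x (V - B))" using sub fin by (intro card_nbrs_mono) auto
      finally show False using x by simp
    qed
    have xB: "s \<le> card (nbrs E x B)"
      using deg[of x] x card_nbrs_split[OF sub(2), of x] by auto
    have "inner_degree_ge E s (insert x B)" unfolding inner_degree_ge_def
    proof (intro conjI ballI)
      fix v assume "v \<in> insert x B"
      then have "s \<le> card (nbrs E v B)" using xB gB by (auto simp: inner_degree_ge_def)
      also have "\<dots> \<le> card (nbrs E v (insert x B))" using finAB by (intro card_nbrs_mono) auto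
      finally show "s \<le> card (nbrs E v (insert x B))" .
    qed auto
    then have "(A, insert x B) \<in> P"
      using sub gA x \<open>x \<notin> A\<close> by (auto simp: P_def)
    then have "card (A \<union> insert x B) \<le> card (A \<union> B)" by (rule max)
    then show False using x \<open>x \<notin> A\<close> finAB by simp
  qed
  then show ?thesis using sub(3) gA gB by (rule that)
qed

end

section \<open>Switchings\<close>

lemma regular_graphsD:
  assumes "G \<in> regular_graphs n d"
  shows "verts G = {1..n}" "simple_graph G" "\<And>v. v \<in> {1..n} \<Longrightarrow> vdegree G v = d"
    "\<And>v. v \<in> {1..n} \<Longrightarrow> card (nbrs (edges G) v {1..n}) = d"
  using assms vdegree_eq_card_nbrs[of G] by (auto simp: regular_graphs_def)

lemma regular_card_arcs:
  assumes G: "G \<in> regular_graphs n d" and A: "A \<subseteq> {1..n}"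
  shows "card (arcs (edges G) A A) + card (arcs (edges G) A ({1..n} - A)) = d * card A"
proof -
  have fin: "finite A" using A by (rule finite_subset) simp
  have "card (arcs (edges G) A A) + card (arcs (edges G) A ({1..n} - A)) =
      card (arcs (edges G) A (A \<union> ({1..n} - A)))"
    by (rule card_arcs_Un_right[symmetric]) (use fin in auto)
  also have "A \<union> ({1..n} - A) = {1..n}" using A by auto
  also have "card (arcs (edges G) A \<dots>) = (\<Sum>v\<in>A. d)"
    using fin A regular_graphsD(4)[OF G] by (simp add: card_arcs subset_iff)
  finally show ?thesis by (simp add: mult.commute)
qed

text \<open>Both sides of the cut see the same number of crossing pairs, so the degree sums over
  \<open>A\<close> and over its complement can be compared.\<close>

lemma regular_card_arcs_complement:
  assumes G: "G \<in> regular_graphs n d" and A: "A \<subseteq> {1..n}"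
  shows "real (card (arcs (edges G) ({1..n} - A) ({1..n} - A))) =
    real d * real n - 2 * real d * real (card A) + real (card (arcs (edges G) A A))"
proof -
  have cA: "card A \<le> n" using card_mono[OF _ A] by simp
  have fin: "finite A" using A by (rule finite_subset) simp
  have "card ({1..n} - A) = n - card A" using A fin by (simp add: card_Diff_subset)
  then have c: "real (card ({1..n} - A)) = real n - real (card A)" using cA by simp
  have VA: "{1..n} - ({1..n} - A) = A" using A by auto
  let ?B = "{1..n} - A"
  have "card (arcs (edges G) ?B ?B) + card (arcs (edges G) ?B A) = d * card ?B"
    using regular_card_arcs[OF G, of ?B] VA by simp
  then have "real (card (arcs (edges G) ?B ?B)) + real (card (arcs (edges G) A ?B)) = real d * real (card ?B)"
    by (metis card_arcs_commute of_nat_add of_nat_mult)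
  moreover have "real (card (arcs (edges G) A A)) + real (card (arcs (edges G) A ?B)) = real d * real (card A)"
    using regular_card_arcs[OF G A] by (metis of_nat_add of_nat_mult)
  moreover have "real d * real (card ?B) = real d * real n - real d * real (card A)"
    unfolding c by (simp add: right_diff_distrib)
  ultimately show ?thesis by linarith
qed

text \<open>The orientations of the two removed edges select one of the two ways to reconnect their
  ends.\<close>

definition switch :: "'a set set \<Rightarrow> ('a \<times> 'a) \<times> 'a \<times> 'a \<Rightarrow> 'a set set" where
  "switch E = (\<lambda>((u, v), (x, y)). insert {u, x} (insert {v, y} (E - {{u, v}, {x, y}})))"

text \<open>The new edges must be absent beforehand; this keeps all degrees and makes the switch
  reversible.\<close>

definition switchable :: "'a set set \<Rightarrow> 'a set \<Rightarrow> 'a set \<Rightarrow> (('a \<times> 'a) \<times> 'a \<times> 'a) set" where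
  "switchable E A B = (SIGMA (u, v):arcs E A A. {(x, y) \<in> arcs E B B. {u, x} \<notin> E \<and> {v, y} \<notin> E})"

lemma card_insert_remove_swap: "finite X \<Longrightarrow> a \<in> X \<Longrightarrow> b \<notin> X \<Longrightarrow> card (insert b (X - {a})) = card X"
  by (metis Diff_iff Suc_diff_1 card_Diff_singleton card_gt_0_iff card_insert_disjoint empty_iff finite_Diff)

text \<open>At an end \<open>w\<close>, the incident edge \<open>c'\<close> is traded for
  \<open>a'\<close>. The two set equations allow either order of the added and of the removed edges,
  so all four ends are covered.\<close>

lemma filter_insert_Diff:
  assumes "{a, b} = {a', b'}" "{c, f} = {c', f'}" "w \<in> a'" "w \<notin> b'" "w \<in> c'" "w \<notin> f'"
  shows "{e \<in> insert a (insert b (E - {c, f})). w \<in> e} = insert a' ({e \<in> E. w \<in> e} - {c'})"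
proof -
  have "insert a (insert b (E - {c, f})) = {a', b'} \<union> (E - {c', f'})"
    using assms(1,2) by auto
  then show ?thesis using assms(3-6) by auto
qed

lemma switch_regular:
  assumes G: "G \<in> regular_graphs n d" and A: "A \<subseteq> {1..n}"
    and p: "p \<in> switchable (edges G) A ({1..n} - A)"
  shows "({1..n}, switch (edges G) p) \<in> regular_graphs n d"
proof -
  obtain u v x y where p': "p = ((u, v), (x, y))" by (metis prod.exhaust)
  let ?E = "edges G" and ?V = "{1..n}"
  have uv: "u \<in> A" "v \<in> A" "{u, v} \<in> ?E" "x \<in> ?V - A" "y \<in> ?V - A" "{x, y} \<in> ?E"
    "{u, x} \<notin> ?E" "{v, y} \<notin> ?E"
    using p by (auto simp: p' switchable_def mem_arcs)
  note loop = simple_graph_no_loop[OF regular_graphsD(2)[OF G]]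
  have ne: "u \<noteq> v" "x \<noteq> y" "u \<noteq> x" "u \<noteq> y" "v \<noteq> x" "v \<noteq> y"
    using uv loop[of u] loop[of x] by auto
  have E': "switch ?E p = insert {u, x} (insert {v, y} (?E - {{u, v}, {x, y}}))"
    by (simp add: switch_def p')
  have finE: "finite ?E"
  proof (rule finite_subset)
    show "?E \<subseteq> Pow ?V" using regular_graphsD(1,2)[OF G] by (auto simp: simple_graph_def)
  qed simp
  have V: "u \<in> ?V" "v \<in> ?V" "x \<in> ?V" "y \<in> ?V" using uv A by auto
  have "simple_graph (?V, switch ?E p)"
    using regular_graphsD(1,2)[OF G] V ne by (auto simp: simple_graph_def E')
  moreover have "vdegree (?V, switch ?E p) w = d" if w: "w \<in> ?V" for w
  proof -
    let ?D = "{e \<in> ?E. w \<in> e}"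
    have D: "card ?D = d" "finite ?D"
      using regular_graphsD(3)[OF G w] finE by (simp_all add: vdegree_def)
    have "card {e \<in> switch ?E p. w \<in> e} = card ?D"
    proof (cases "w \<in> {u, v, x, y}")
      case False
      then have "{e \<in> switch ?E p. w \<in> e} = ?D" by (auto simp: E')
      then show ?thesis by simp
    next
      case True
      then consider "w = u" | "w = v" | "w = x" | "w = y" by auto
      then show ?thesis
      proof cases
        case 1
        have "{e \<in> switch ?E p. w \<in> e} = insert {u, x} (?D - {{u, v}})"
          unfolding E' by (rule filter_insert_Diff[where b' = "{v, y}" and f' = "{x, y}"])
            (use ne 1 in \<open>simp_all add: insert_commute\<close>)
        also have "card \<dots> = card ?D" using D uv 1 by (intro card_insert_remove_swap) simp_all
        finally show ?thesis .
      next
        case 2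
        have "{e \<in> switch ?E p. w \<in> e} = insert {v, y} (?D - {{u, v}})"
          unfolding E' by (rule filter_insert_Diff[where b' = "{u, x}" and f' = "{x, y}"])
            (use ne 2 in \<open>simp_all add: insert_commute\<close>)
        also have "card \<dots> = card ?D" using D uv 2 by (intro card_insert_remove_swap) simp_all
        finally show ?thesis .
      next
        case 3
        have "{e \<in> switch ?E p. w \<in> e} = insert {u, x} (?D - {{x, y}})"
          unfolding E' by (rule filter_insert_Diff[where b' = "{v, y}" and f' = "{u, v}"])
            (use ne 3 in \<open>simp_all add: insert_commute\<close>)
        also have "card \<dots> = card ?D" using D uv 3 by (intro card_insert_remove_swap) simp_all
        finally show ?thesis .
      next
        case 4
        have "{e \<in> switch ?E p. w \<in> e} = insert {v, y} (?D - {{x, y}})"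
          unfolding E' by (rule filter_insert_Diff[where b' = "{u, x}" and f' = "{u, v}"])
            (use ne 4 in \<open>simp_all add: insert_commute\<close>)
        also have "card \<dots> = card ?D" using D uv 4 by (intro card_insert_remove_swap) simp_all
        finally show ?thesis .
      qed
    qed
    then show ?thesis using D by (simp add: vdegree_def)
  qed
  ultimately show ?thesis by (simp add: regular_graphs_def)
qed

text \<open>Both new edges cross the cut, so only \<open>(u, v)\<close> and \<open>(v, u)\<close>
  are lost inside \<open>A\<close>; they are distinct since there are no loops.\<close>

lemma card_arcs_switch:
  assumes G: "G \<in> regular_graphs n d" and A: "A \<subseteq> {1..n}"
    and p: "p \<in> switchable (edges G) A ({1..n} - A)"
  shows "card (arcs (edges G) A A) = card (arcs (switch (edges G) p) A A) + 2"
proof -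
  obtain u v x y where p': "p = ((u, v), (x, y))" by (metis prod.exhaust)
  let ?E = "edges G"
  have uv: "u \<in> A" "v \<in> A" "{u, v} \<in> ?E" "x \<notin> A" "y \<notin> A"
    using p by (auto simp: p' switchable_def mem_arcs)
  have "u \<noteq> v"
    using uv simple_graph_no_loop[OF regular_graphsD(2)[OF G], of u] by auto
  have fin: "finite A" using A by (rule finite_subset) simp
  have "arcs (switch ?E p) A A = arcs ?E A A - {(u, v), (v, u)}"
    using uv by (auto simp: mem_arcs switch_def p' doubleton_eq_iff)
  moreover have sub: "{(u, v), (v, u)} \<subseteq> arcs ?E A A"
    using uv by (auto simp: mem_arcs insert_commute)
  moreover have "card {(u, v), (v, u)} = 2" using \<open>u \<noteq> v\<close> by simp
  ultimately show ?thesis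
    using card_Diff_subset[OF _ sub] card_mono[OF _ sub] fin by simp
qed

text \<open>For fixed \<open>(u, v)\<close>, a pair \<open>(x, y)\<close> is forbidden only if
  \<open>x\<close> is a neighbour of \<open>u\<close> or \<open>y\<close> one of \<open>v\<close>.
  Each case has at most \<open>d\<close> choices for that end and then at most \<open>d\<close> for
  the other.\<close>

lemma card_switchable_ge:
  assumes G: "G \<in> regular_graphs n d" and A: "A \<subseteq> {1..n}"
  shows "real (card (arcs (edges G) A A)) *
      (real (card (arcs (edges G) ({1..n} - A) ({1..n} - A))) - 2 * (real d)\<^sup>2)
    \<le> real (card (switchable (edges G) A ({1..n} - A)))"
proof -
  let ?E = "edges G" and ?B = "{1..n} - A"
  have fin: "finite A" using A by (rule finite_subset) simp
  define L where "L = (\<lambda>(u, v). {(x, y) \<in> arcs ?E ?B ?B. {u, x} \<notin> ?E \<and> {v, y} \<notin> ?E})"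
  have L: "switchable ?E A ?B = Sigma (arcs ?E A A) L"
    by (auto simp: switchable_def L_def)
  have deg: "card (nbrs ?E w ?B) \<le> d" if "w \<in> {1..n}" for w
    using regular_graphsD(4)[OF G that] card_nbrs_mono[of ?B "{1..n}" ?E w] by auto
  have two: "card (SIGMA x:nbrs ?E w ?B. nbrs ?E x ?B) \<le> d * d" if w: "w \<in> {1..n}" for w
  proof -
    have "card (SIGMA x:nbrs ?E w ?B. nbrs ?E x ?B) = (\<Sum>x\<in>nbrs ?E w ?B. card (nbrs ?E x ?B))"
      by simp
    also have "\<dots> \<le> (\<Sum>x\<in>nbrs ?E w ?B. d)"
      by (intro sum_mono deg) (auto simp: nbrs_def)
    also have "\<dots> \<le> d * d" using deg[OF w] by simp
    finally show ?thesis .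
  qed
  have bound: "real (card (arcs ?E ?B ?B)) - 2 * (real d)\<^sup>2 \<le> real (card (L a))"
    if a: "a \<in> arcs ?E A A" for a
  proof -
    obtain u v where a': "a = (u, v)" by (cases a)
    with a have "u \<in> A" "v \<in> A" by (simp_all add: mem_arcs)
    with a' A have uv: "a = (u, v)" "u \<in> {1..n}" "v \<in> {1..n}" by blast+
    let ?X = "SIGMA x:nbrs ?E u ?B. nbrs ?E x ?B" and ?Y = "SIGMA x:nbrs ?E v ?B. nbrs ?E x ?B"
    have "arcs ?E ?B ?B \<subseteq> L a \<union> (?X \<union> prod.swap ` ?Y)"
    proof
      fix e assume e: "e \<in> arcs ?E ?B ?B"
      obtain x y where xy: "e = (x, y)" by (cases e)
      show "e \<in> L a \<union> (?X \<union> prod.swap ` ?Y)"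
      proof (cases "{v, y} \<in> ?E")
        case True
        then have "(y, x) \<in> ?Y" using e xy by (auto simp: mem_arcs nbrs_def insert_commute)
        then have "prod.swap (y, x) \<in> prod.swap ` ?Y" by (rule imageI)
        then show ?thesis using xy by simp
      next
        case False
        then show ?thesis using e xy uv by (auto simp: L_def mem_arcs nbrs_def)
      qed
    qed
    moreover have "L a \<subseteq> arcs ?E ?B ?B" by (auto simp: L_def uv)
    then have "finite (L a)" by (rule finite_subset) simp
    ultimately have "card (arcs ?E ?B ?B) \<le> card (L a \<union> (?X \<union> prod.swap ` ?Y))"
      by (intro card_mono) auto
    also have "\<dots> \<le> card (L a) + (card ?X + card (prod.swap ` ?Y))"
      by (meson card_Un_le add_left_mono le_trans)
    also have "card (prod.swap ` ?Y) = card ?Y" by (simp add: card_image)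
    also have "card (L a) + (card ?X + card ?Y) \<le> card (L a) + 2 * (d * d)"
      using two[OF uv(2)] two[OF uv(3)] by linarith
    finally have "real (card (arcs ?E ?B ?B)) \<le> real (card (L a) + 2 * (d * d))"
      by (simp only: of_nat_le_iff)
    then show ?thesis by (simp add: power2_eq_square)
  qed
  have "finite (L a)" for a
  proof (rule finite_subset)
    show "L a \<subseteq> arcs ?E ?B ?B" by (auto simp: L_def)
  qed simp
  then have "real (card (switchable ?E A ?B)) = (\<Sum>a\<in>arcs ?E A A. real (card (L a)))"
    unfolding L by (subst card_SigmaI) (use fin in auto)
  also have "\<dots> \<ge> (\<Sum>a\<in>arcs ?E A A. real (card (arcs ?E ?B ?B)) - 2 * (real d)\<^sup>2)"
    by (intro sum_mono bound)
  finally show ?thesis by simp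
qed

lemma finite_switchable: "finite A \<Longrightarrow> finite B \<Longrightarrow> finite (switchable E A B)"
  unfolding switchable_def
  by (rule finite_SigmaI) (auto intro: finite_subset[of _ "arcs E B B"])

section \<open>Ratios between the numbers of graphs with given density in a set\<close>

definition regular_with_arcs :: "nat \<Rightarrow> nat \<Rightarrow> nat set \<Rightarrow> nat \<Rightarrow> nat graph set" where
  "regular_with_arcs n d A t = {G \<in> regular_graphs n d. card (arcs (edges G) A A) = t}"

lemma switch_undo:
  assumes E: "\<And>w. {w} \<notin> E" and AB: "A \<inter> B = {}" and p: "((u, v), (x, y)) \<in> switchable E A B"
  shows "E = insert {u, v} (insert {x, y} (switch E ((u, v), (x, y)) - {{u, x}, {v, y}}))"
proof -
  have "u \<in> A" "v \<in> A" "{u, v} \<in> E" "x \<in> B" "y \<in> B" "{x, y} \<in> E" "{u, x} \<notin> E" "{v, y} \<notin> E"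
    using p by (auto simp: switchable_def mem_arcs)
  then show ?thesis by (auto simp: switch_def)
qed

text \<open>Double counting of switches: graphs at level \<open>t + 2\<close> together with a
  possible switch inject into graphs at level \<open>t\<close> together with two ordered crossing
  pairs.\<close>

lemma card_regular_with_arcs_step:
  assumes A: "A \<subseteq> {1..n}"
  shows "real (card (regular_with_arcs n d A (t + 2))) *
      ((real t + 2) * (real d * real n - 2 * real d * real (card A) + real t + 2 - 2 * (real d)\<^sup>2))
    \<le> real (card (regular_with_arcs n d A t)) * (real d * real (card A) - real t)\<^sup>2"
proof -
  let ?B = "{1..n} - A"
  let ?R = "regular_with_arcs n d A"
  let ?L = "\<lambda>G. switchable (edges G) A ?B"
  let ?M = "\<lambda>G. arcs (edges G) A ?B \<times> arcs (edges G) A ?B"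
  have finA: "finite A" using A by (rule finite_subset) simp
  have finR: "finite (?R s)" for s
    using finite_regular_graphs by (simp add: regular_with_arcs_def)
  \<comment> \<open>The image remembers the two new edges, hence all four vertices, and
    \<open>switch_undo\<close> then recovers the original graph.\<close>
  define \<phi> where "\<phi> = (\<lambda>(G :: nat graph, p). (({1..n}, switch (edges G) p),
      (case p of ((u, v), (x, y)) \<Rightarrow> ((u, x), (v, y)))))"
  have "inj_on \<phi> (Sigma (?R (t + 2)) ?L)"
  proof (rule inj_onI)
    fix a b assume a: "a \<in> Sigma (?R (t + 2)) ?L" and b: "b \<in> Sigma (?R (t + 2)) ?L"
      and eq: "\<phi> a = \<phi> b"
    obtain G u v x y where a': "a = (G, ((u, v), (x, y)))" by (metis prod.exhaust)
    obtain G' u' v' x' y' where b': "b = (G', ((u', v'), (x', y')))" by (metis prod.exhaust)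
    have same: "u' = u" "v' = v" "x' = x" "y' = y"
      and sw: "switch (edges G) ((u, v), (x, y)) = switch (edges G') ((u, v), (x, y))"
      using eq by (auto simp: \<phi>_def a' b')
    have G: "G \<in> regular_graphs n d" "G' \<in> regular_graphs n d"
      using a b by (auto simp: a' b' regular_with_arcs_def)
    have "edges G = edges G'"
      using switch_undo[OF simple_graph_no_loop[OF regular_graphsD(2)[OF G(1)]], of A ?B u v x y]
        switch_undo[OF simple_graph_no_loop[OF regular_graphsD(2)[OF G(2)]], of A ?B u v x y]
        a b sw same by (auto simp: a' b')
    then show "a = b"
      using regular_graphsD(1)[OF G(1)] regular_graphsD(1)[OF G(2)] same
      by (simp add: a' b' prod_eq_iff)
  qed
  moreover have "\<phi> ` Sigma (?R (t + 2)) ?L \<subseteq> Sigma (?R t) ?M"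
  proof (rule image_subsetI)
    fix a assume a: "a \<in> Sigma (?R (t + 2)) ?L"
    obtain G u v x y where a': "a = (G, ((u, v), (x, y)))" by (metis prod.exhaust)
    let ?p = "((u, v), (x, y))"
    have G: "G \<in> regular_graphs n d" "card (arcs (edges G) A A) = t + 2" and p: "?p \<in> ?L G"
      using a by (auto simp: a' regular_with_arcs_def)
    have "({1..n}, switch (edges G) ?p) \<in> ?R t"
      using switch_regular[OF G(1) A p] card_arcs_switch[OF G(1) A p] G(2)
      by (simp add: regular_with_arcs_def)
    moreover have "((u, x), (v, y)) \<in> ?M ({1..n}, switch (edges G) ?p)"
      using p by (auto simp: switchable_def mem_arcs switch_def)
    ultimately show "\<phi> a \<in> Sigma (?R t) ?M" by (simp add: \<phi>_def a')
  qed
  moreover have "finite (Sigma (?R t) ?M)" using finR finA by (intro finite_SigmaI) auto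
  ultimately have "card (Sigma (?R (t + 2)) ?L) \<le> card (Sigma (?R t) ?M)"
    using card_inj_on_le by blast
  then have "real (card (Sigma (?R (t + 2)) ?L)) \<le> real (card (Sigma (?R t) ?M))" by simp
  moreover have "real (card (Sigma (?R t) ?M)) =
      real (card (?R t)) * (real d * real (card A) - real t)\<^sup>2"
  proof -
    \<comment> \<open>The inequality is carried along so that the natural-number difference becomes
      the real one.\<close>
    have "card (?M G) = (d * card A - t)\<^sup>2 \<and> t \<le> d * card A" if G: "G \<in> ?R t" for G
    proof -
      have "t + card (arcs (edges G) A ?B) = d * card A"
        using G regular_card_arcs[of G n d A] A by (auto simp: regular_with_arcs_def)
      then have "card (arcs (edges G) A ?B) = d * card A - t" "t \<le> d * card A" by linarith+
      then show ?thesis by (simp only: card_cartesian_product power2_eq_square)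
    qed
    then have "real (card (?M G)) = (real d * real (card A) - real t)\<^sup>2" if "G \<in> ?R t" for G
      using that by (metis of_nat_diff of_nat_mult of_nat_power)
    then have "(\<Sum>G\<in>?R t. real (card (?M G))) = (\<Sum>G\<in>?R t. (real d * real (card A) - real t)\<^sup>2)"
      by (intro sum.cong) auto
    moreover have "card (Sigma (?R t) ?M) = (\<Sum>G\<in>?R t. card (?M G))"
      using finR finA by (intro card_SigmaI) auto
    ultimately show ?thesis by simp
  qed
  moreover have "real (card (?R (t + 2))) *
      ((real t + 2) * (real d * real n - 2 * real d * real (card A) + real t + 2 - 2 * (real d)\<^sup>2))
      \<le> real (card (Sigma (?R (t + 2)) ?L))"
  proof -
    have "(real t + 2) * (real d * real n - 2 * real d * real (card A) + real t + 2 - 2 * (real d)\<^sup>2)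
        \<le> real (card (?L G))" if "G \<in> ?R (t + 2)" for G
    proof -
      have G: "G \<in> regular_graphs n d" "card (arcs (edges G) A A) = t + 2"
        using that by (auto simp: regular_with_arcs_def)
      have "real d * real n - 2 * real d * real (card A) + real t + 2 =
          real (card (arcs (edges G) ?B ?B))"
        using regular_card_arcs_complement[OF G(1) A] G(2) by simp
      then show ?thesis
        using card_switchable_ge[OF G(1) A] G(2) by (simp add: add.commute)
    qed
    then have "(\<Sum>G\<in>?R (t + 2). (real t + 2) *
        (real d * real n - 2 * real d * real (card A) + real t + 2 - 2 * (real d)\<^sup>2))
        \<le> (\<Sum>G\<in>?R (t + 2). real (card (?L G)))"
      by (rule sum_mono)
    moreover have "card (Sigma (?R (t + 2)) ?L) = (\<Sum>G\<in>?R (t + 2). card (?L G))"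
      using finR finA by (intro card_SigmaI) (auto intro: finite_switchable)
    ultimately show ?thesis by simp
  qed
  ultimately show ?thesis by linarith
qed

definition regular_with_arcs_ge :: "nat \<Rightarrow> nat \<Rightarrow> nat set \<Rightarrow> nat \<Rightarrow> nat graph set" where
  "regular_with_arcs_ge n d A t = {G \<in> regular_graphs n d. t \<le> card (arcs (edges G) A A)}"

text \<open>Levels above \<open>d * card A\<close> are empty; the extra 2 in the upper limit fits
  the index shift in \<open>card_regular_with_arcs_ge_step\<close>.\<close>

lemma regular_with_arcs_ge_Union:
  assumes "A \<subseteq> {1..n}"
  shows "real (card (regular_with_arcs_ge n d A t)) =
    (\<Sum>s\<in>{t..max t (d * card A + 2)}. real (card (regular_with_arcs n d A s)))"
proof -
  have "regular_with_arcs_ge n d A t = (\<Union>s\<in>{t..max t (d * card A + 2)}. regular_with_arcs n d A s)"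
  proof (intro set_eqI iffI)
    fix G assume G: "G \<in> regular_with_arcs_ge n d A t"
    then have "card (arcs (edges G) A A) \<le> d * card A"
      using regular_card_arcs[of G n d A] assms by (simp add: regular_with_arcs_ge_def)
    with G show "G \<in> (\<Union>s\<in>{t..max t (d * card A + 2)}. regular_with_arcs n d A s)"
      by (auto simp: regular_with_arcs_ge_def regular_with_arcs_def)
  qed (auto simp: regular_with_arcs_ge_def regular_with_arcs_def)
  moreover have "card (\<Union>s\<in>{t..max t (d * card A + 2)}. regular_with_arcs n d A s) =
      (\<Sum>s\<in>{t..max t (d * card A + 2)}. card (regular_with_arcs n d A s))"
    using finite_regular_graphs
    by (intro card_UN_disjoint) (auto simp: regular_with_arcs_def)
  ultimately show ?thesis by simp
qed

text \<open>As the level rises from \<open>t\<close> to \<open>d * card A\<close>, the numerator of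
  the switching ratio decreases and its denominator increases. The ratio at \<open>t\<close>
  therefore bounds all later ones, and summation over the levels transfers it to the tails.\<close>

lemma card_regular_with_arcs_ge_step:
  assumes A: "A \<subseteq> {1..n}" and t: "t \<le> d * card A"
    and pos: "0 < real d * real n - 2 * real d * real (card A) + real t + 2 - 2 * (real d)\<^sup>2"
  shows "real (card (regular_with_arcs_ge n d A (t + 2))) \<le>
    real (card (regular_with_arcs_ge n d A t)) * ((real d * real (card A) - real t)\<^sup>2 /
      ((real t + 2) * (real d * real n - 2 * real d * real (card A) + real t + 2 - 2 * (real d)\<^sup>2)))"
proof -
  define D where "D = (\<lambda>s. (real s + 2) * (real d * real n - 2 * real d * real (card A) + real s + 2 - 2 * (real d)\<^sup>2))"
  define q where "q = (real d * real (card A) - real t)\<^sup>2 / D t"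
  let ?R = "\<lambda>s. real (card (regular_with_arcs n d A s))"
  have step: "?R (s + 2) \<le> ?R s * q" if s: "t \<le> s" for s
  proof (cases "s \<le> d * card A")
    case False
    have "regular_with_arcs n d A (s + 2) = {}"
    proof -
      have False if "G \<in> regular_with_arcs n d A (s + 2)" for G
        using that regular_card_arcs[of G n d A] A False by (simp add: regular_with_arcs_def)
      then show ?thesis by blast
    qed
    then show ?thesis using pos by (simp add: q_def D_def)
  next
    case True
    then have "real s \<le> real d * real (card A)" by (metis of_nat_le_iff of_nat_mult)
    then have sq: "(real d * real (card A) - real s)\<^sup>2 \<le> (real d * real (card A) - real t)\<^sup>2"
      using s by (intro power_mono) auto
    have Dt: "0 < D t" using pos by (simp add: D_def)
    have DD: "D t \<le> D s" unfolding D_def using s pos by (intro mult_mono) auto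
    have "?R (s + 2) * D t \<le> ?R (s + 2) * D s" using DD by (intro mult_left_mono) auto
    also have "\<dots> \<le> ?R s * (real d * real (card A) - real s)\<^sup>2"
      unfolding D_def by (rule card_regular_with_arcs_step[OF A])
    also have "\<dots> \<le> ?R s * (real d * real (card A) - real t)\<^sup>2"
      using sq by (intro mult_left_mono) auto
    finally show ?thesis using Dt by (simp add: q_def field_simps)
  qed
  let ?m = "d * card A + 2"
  have "real (card (regular_with_arcs_ge n d A (t + 2))) = (\<Sum>s\<in>{t + 2..?m}. ?R s)"
    using regular_with_arcs_ge_Union[OF A, of d "t + 2"] t by (simp add: max_absorb2)
  also have "\<dots> = (\<Sum>s\<in>{t..d * card A}. ?R (s + 2))"
    using sum.shift_bounds_cl_nat_ivl[of ?R t 2 "d * card A"] by simp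
  also have "\<dots> \<le> (\<Sum>s\<in>{t..d * card A}. ?R s * q)"
    by (intro sum_mono step) auto
  also have "\<dots> = (\<Sum>s\<in>{t..d * card A}. ?R s) * q" by (simp add: sum_distrib_right)
  also have "\<dots> \<le> (\<Sum>s\<in>{t..max t ?m}. ?R s) * q"
    using pos by (intro mult_right_mono sum_mono2) (auto simp: q_def D_def)
  also have "(\<Sum>s\<in>{t..max t ?m}. ?R s) = real (card (regular_with_arcs_ge n d A t))"
    using regular_with_arcs_ge_Union[OF A] by simp
  finally show ?thesis by (simp add: q_def D_def)
qed

text \<open>Iterates the tail ratio from the trivial bound by all regular graphs. The
  \<open>+ 2\<close> in the hypothesis reflects that only the starting level of the last step must
  be at most \<open>d * card A\<close>.\<close>

lemma card_regular_with_arcs_ge_prod: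
  assumes A: "A \<subseteq> {1..n}" and t: "t + 2 * j \<le> d * card A + 2"
    and pos: "0 < real d * real n - 2 * real d * real (card A) + real t + 2 - 2 * (real d)\<^sup>2"
  shows "real (card (regular_with_arcs_ge n d A (t + 2 * j))) \<le>
    real (card (regular_graphs n d)) * (\<Prod>i<j. (real d * real (card A) - real (t + 2 * i))\<^sup>2 /
      ((real (t + 2 * i) + 2) *
        (real d * real n - 2 * real d * real (card A) + real (t + 2 * i) + 2 - 2 * (real d)\<^sup>2)))"
  using t
proof (induction j)
  case 0
  show ?case using finite_regular_graphs
    by (auto simp: regular_with_arcs_ge_def intro!: card_mono)
next
  case (Suc j)
  define Q where "Q = (\<lambda>i. (real d * real (card A) - real (t + 2 * i))\<^sup>2 /
      ((real (t + 2 * i) + 2) *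
        (real d * real n - 2 * real d * real (card A) + real (t + 2 * i) + 2 - 2 * (real d)\<^sup>2)))"
  have Q0: "0 \<le> Q i" for i using pos by (auto simp: Q_def intro!: divide_nonneg_nonneg mult_nonneg_nonneg)
  have "real (card (regular_with_arcs_ge n d A (t + 2 * j + 2))) \<le>
      real (card (regular_with_arcs_ge n d A (t + 2 * j))) * Q j"
    unfolding Q_def using Suc.prems pos by (intro card_regular_with_arcs_ge_step[OF A]) auto
  also have "\<dots> \<le> real (card (regular_graphs n d)) * (\<Prod>i<j. Q i) * Q j"
    using Suc Q0 by (intro mult_right_mono) (auto simp: Q_def)
  finally show ?case by (simp add: Q_def mult.assoc algebra_simps)
qed

section \<open>Existence of regular graphs\<close>

text \<open>Translation modulo \<open>n\<close> maps \<open>{1..n}\<close> bijectively onto the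
  residues.\<close>

lemma card_add_mod_in:
  fixes n c :: nat
  assumes "T \<subseteq> {..<n}"
  shows "card {j \<in> {1..n}. (c + j) mod n \<in> T} = card T"
proof -
  let ?f = "\<lambda>j. (c + j) mod n"
  have inj: "inj_on ?f {1..n}"
  proof (rule linorder_inj_onI')
    fix i j assume ij: "i \<in> {1..n}" "j \<in> {1..n}" "i < j"
    show "?f i \<noteq> ?f j"
    proof
      assume "?f i = ?f j"
      then have "n dvd (c + j) - (c + i)" using ij by (intro mod_eq_dvd_iff_nat[THEN iffD1]) auto
      then have "n dvd j - i" by simp
      then show False using ij by (auto dest: dvd_imp_le)
    qed
  qed
  have "?f ` {1..n} = {..<n}"
  proof (cases "n = 0")
    case False
    then have "?f ` {1..n} \<subseteq> {..<n}" by auto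
    moreover have "card (?f ` {1..n}) = card {..<n}" using inj by (simp add: card_image)
    ultimately show ?thesis by (simp add: card_subset_eq)
  qed simp
  moreover have "f ` {j \<in> X. f j \<in> T} = f ` X \<inter> T" for f :: "nat \<Rightarrow> nat" and X by auto
  ultimately have "?f ` {j \<in> {1..n}. ?f j \<in> T} = {..<n} \<inter> T" by metis
  also have "\<dots> = T" using assms by (rule Int_absorb1)
  finally have "card T = card (?f ` {j \<in> {1..n}. ?f j \<in> T})" by simp
  also have "\<dots> = card {j \<in> {1..n}. ?f j \<in> T}"
    by (rule card_image, rule inj_on_subset[OF inj]) blast
  finally show ?thesis by simp
qed

lemma regular_graphs_nonempty_of_relation:
  assumes sym: "\<And>i j. i \<in> {1..n} \<Longrightarrow> j \<in> {1..n} \<Longrightarrow> P i j \<Longrightarrow> P j i"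
    and irr: "\<And>i. i \<in> {1..n} \<Longrightarrow> \<not> P i i"
    and deg: "\<And>i. i \<in> {1..n} \<Longrightarrow> card {j \<in> {1..n}. P i j} = d"
  shows "regular_graphs n d \<noteq> {}"
proof -
  define G where "G = ({1..n}, {{i, j} |i j. i \<in> {1..n} \<and> j \<in> {1..n} \<and> P i j})"
  have "card {i, j} = 2" if "i \<in> {1..n}" "P i j" for i j
    using irr[OF that(1)] that(2) by (cases "i = j") auto
  then have s: "simple_graph G" by (auto simp: simple_graph_def G_def)
  have "nbrs (edges G) v (verts G) = {j \<in> {1..n}. P v j}" if "v \<in> {1..n}" for v
    using that sym by (auto simp: nbrs_def G_def doubleton_eq_iff)
  then have "vdegree G v = d" if "v \<in> {1..n}" for v
    using that deg by (simp add: vdegree_eq_card_nbrs[OF s])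
  with s have "G \<in> regular_graphs n d" by (simp add: regular_graphs_def G_def)
  then show ?thesis by auto
qed

text \<open>For even \<open>n\<close> the sum graph of \<open>d\<close> odd residues has no loops; for odd \<open>n\<close> a circulant
  graph does it.\<close>

lemma regular_graphs_nonempty:
  assumes "even (d * n)" "2 * d < n"
  shows "regular_graphs n d \<noteq> {}"
proof (cases "even n")
  case True
  let ?T = "(\<lambda>k. 2 * k + 1) ` {..<d}"
  show ?thesis
  proof (rule regular_graphs_nonempty_of_relation[where P = "\<lambda>i j. (i + j) mod n \<in> ?T"])
    fix i show "card {j \<in> {1..n}. (i + j) mod n \<in> ?T} = d"
      using assms(2) by (subst card_add_mod_in) (auto simp: card_image inj_on_def)
    \<comment> \<open>For even \<open>n\<close>, reduction modulo \<open>n\<close> preserves parity,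
      whereas \<open>?T\<close> contains only odd residues.\<close>
    have "even ((i + i) mod n)" using True by (auto simp: dvd_mod_iff)
    then show "(i + i) mod n \<notin> ?T" by (metis (no_types, lifting) imageE even_plus_one_iff dvd_triv_left)
  qed (simp add: add.commute)
next
  case False
  then obtain m where m: "d = 2 * m" using assms(1) by auto
  \<comment> \<open>The nonzero residues at distance at most \<open>m\<close> from 0: closed under
    negation, and \<open>d = 2 * m\<close> in number because \<open>2 * d < n\<close>.\<close>
  let ?T = "{1..m} \<union> {n - m..<n}"
  have T: "n - r \<in> ?T" if "r \<in> ?T" for r using that assms(2) m by auto
  show ?thesis
  proof (rule regular_graphs_nonempty_of_relation[where P = "\<lambda>i j. (n - i + j) mod n \<in> ?T"])
    fix i assume i: "i \<in> {1..n}"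
    have "{1..m} \<inter> {n - m..<n} = {}" using assms(2) m by auto
    then have "card ?T = d" using assms(2) m by (subst card_Un_disjoint) auto
    then show "card {j \<in> {1..n}. (n - i + j) mod n \<in> ?T} = d"
      using assms(2) m by (subst card_add_mod_in) auto
    show "(n - i + i) mod n \<notin> ?T" using i assms(2) m by auto
    fix j assume j: "j \<in> {1..n}" and r: "(n - i + j) mod n \<in> ?T"
    let ?r = "(n - i + j) mod n" and ?r' = "(n - j + i) mod n"
    have "(?r + ?r') mod n = (n - i + j + (n - j + i)) mod n" by (simp add: mod_add_eq)
    also have "n - i + j + (n - j + i) = 2 * n" using i j by auto
    finally have "n dvd ?r + ?r'" by (simp add: dvd_eq_mod_eq_0)
    then obtain q where q: "?r + ?r' = n * q" by (auto simp: dvd_def)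
    have "?r < n" "?r' < n" "0 < ?r" using r i j assms(2) m by auto
    \<comment> \<open>The residues of opposite differences add up to a multiple of \<open>n\<close>
      strictly between 0 and \<open>2 * n\<close>, hence to \<open>n\<close> itself.\<close>
    then have "0 < n * q" "n * q < n * 2" using q by linarith+
    then have "q = 1" by auto
    then have "?r' = n - ?r" using q by simp
    then show "(n - j + i) mod n \<in> ?T" using T[OF r] by simp
  qed
qed

section \<open>First-moment bounds for dense sets\<close>

lemma card_regular_union_bound:
  fixes T :: "nat set \<Rightarrow> nat graph set"
  assumes "finite I" and T: "\<And>A. A \<subseteq> {1..n} \<Longrightarrow> card A \<in> I \<Longrightarrow> T A \<subseteq> regular_graphs n d"
    and p: "\<And>A. A \<subseteq> {1..n} \<Longrightarrow> card A \<in> I \<Longrightarrow> real (card (T A)) \<le> p (card A)"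
  shows "real (card {G. \<exists>A. A \<subseteq> {1..n} \<and> card A \<in> I \<and> G \<in> T A}) \<le>
    (\<Sum>a\<in>I. real (n choose a) * p a)"
proof -
  let ?F = "\<lambda>a. {A. A \<subseteq> {1..n} \<and> card A = a}"
  have finF: "finite (?F a)" for a by simp
  have "{G. \<exists>A. A \<subseteq> {1..n} \<and> card A \<in> I \<and> G \<in> T A} = (\<Union>a\<in>I. \<Union>A\<in>?F a. T A)" by auto
  then have "card {G. \<exists>A. A \<subseteq> {1..n} \<and> card A \<in> I \<and> G \<in> T A} \<le> (\<Sum>a\<in>I. card (\<Union>A\<in>?F a. T A))"
    using card_UN_le[OF assms(1)] by simp
  also have "\<dots> \<le> (\<Sum>a\<in>I. \<Sum>A\<in>?F a. card (T A))"
    by (intro sum_mono card_UN_le finF)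
  finally have "real (card {G. \<exists>A. A \<subseteq> {1..n} \<and> card A \<in> I \<and> G \<in> T A}) \<le>
      real (\<Sum>a\<in>I. \<Sum>A\<in>?F a. card (T A))"
    by (rule of_nat_mono)
  also have "\<dots> = (\<Sum>a\<in>I. \<Sum>A\<in>?F a. real (card (T A)))" by simp
  also have "\<dots> \<le> (\<Sum>a\<in>I. \<Sum>A\<in>?F a. p a)"
    by (intro sum_mono) (use p in auto)
  also have "\<dots> = (\<Sum>a\<in>I. real (n choose a) * p a)"
    using n_subsets[of "{1..n}"] by simp
  finally show ?thesis .
qed

text \<open>In terms of edges: a set of at most \<open>M\<close> vertices that spans at least
  \<open>card A + 1\<close> edges, more than it has vertices.\<close>

definition dense_small :: "nat \<Rightarrow> nat \<Rightarrow> nat \<Rightarrow> nat graph set" where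
  "dense_small n d M = {G. \<exists>A. A \<subseteq> {1..n} \<and> card A \<in> {..M} \<and> G \<in> regular_with_arcs_ge n d A (2 * card A + 2)}"

lemma regular_with_arcs_ge_subset: "regular_with_arcs_ge n d A t \<subseteq> regular_graphs n d"
  by (auto simp: regular_with_arcs_ge_def)

text \<open>Starting from level 0, \<open>a + 1\<close> switching ratios of order
  \<open>1 / n\<close> are available for sets of size \<open>a\<close>. They beat the at most
  \<open>n ^ a\<close> choices of the set by one factor \<open>n\<close>.\<close>

lemma card_dense_small:
  assumes d: "2 \<le> d" and n: "4 * M + 4 * d \<le> n"
  shows "real (card (dense_small n d M)) \<le>
    (real M + 1) * (real d * (real M)\<^sup>2 + 1) ^ (M + 1) / real n * real (card (regular_graphs n d))"
proof -
  let ?N = "real (card (regular_graphs n d))"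
  \<comment> \<open>The summand 1 makes \<open>?b\<close> at least 1, so that its powers increase up
    to the exponent \<open>M + 1\<close>.\<close>
  let ?b = "real d * (real M)\<^sup>2 + 1"
  have n0: "0 < real n" using n d by auto
  have p: "real (card (regular_with_arcs_ge n d A (2 * card A + 2))) \<le> ?N * (?b / real n) ^ (card A + 1)"
    if A: "A \<subseteq> {1..n}" and cA: "card A \<in> {..M}" for A
  proof -
    let ?x = "card A"
    have "real (4 * M + 4 * d) \<le> real n" using n by (simp only: of_nat_le_iff)
    moreover have x: "real ?x \<le> real M" using cA by simp
    ultimately have "4 * real ?x + 4 * real d \<le> real n" by simp
    then have "real d * (4 * real ?x + 4 * real d) \<le> real d * real n" by (intro mult_left_mono) auto
    then have half: "real d * real n / 2 \<le> real d * real n - 2 * real d * real ?x - 2 * (real d)\<^sup>2"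
      by (simp add: algebra_simps power2_eq_square)
    have dn: "0 < real d * real n" using n0 d by simp
    have cond: "0 + 2 * (?x + 1) \<le> d * ?x + 2"
      using d mult_le_mono1[of 2 d ?x] by simp
    have "real (card (regular_with_arcs_ge n d A (0 + 2 * (?x + 1)))) \<le>
      ?N * (\<Prod>i<?x + 1. (real d * real ?x - real (0 + 2 * i))\<^sup>2 /
      ((real (0 + 2 * i) + 2) *
        (real d * real n - 2 * real d * real ?x + real (0 + 2 * i) + 2 - 2 * (real d)\<^sup>2)))"
      by (rule card_regular_with_arcs_ge_prod[OF A cond]) (use half dn in linarith)
    also have "(\<Prod>i<?x + 1. (real d * real ?x - real (0 + 2 * i))\<^sup>2 /
      ((real (0 + 2 * i) + 2) *
        (real d * real n - 2 * real d * real ?x + real (0 + 2 * i) + 2 - 2 * (real d)\<^sup>2)))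
      \<le> (\<Prod>i<?x + 1. ?b / real n)"
    proof (rule prod_mono)
      fix i assume "i \<in> {..<?x + 1}"
      then have "2 * i \<le> d * ?x" using d mult_le_mono[of 2 d i ?x] by auto
      then have "real (2 * i) \<le> real (d * ?x)" by (simp only: of_nat_le_iff)
      then have "(real d * real ?x - real (0 + 2 * i))\<^sup>2 \<le> (real d * real ?x)\<^sup>2"
        by (intro power_mono) auto
      also have "\<dots> \<le> (real d * real M)\<^sup>2" using x by (intro power_mono mult_left_mono) auto
      finally have num: "(real d * real ?x - real (0 + 2 * i))\<^sup>2 \<le> (real d * real M)\<^sup>2" .
      have den: "real d * real n \<le> (real (0 + 2 * i) + 2) *
        (real d * real n - 2 * real d * real ?x + real (0 + 2 * i) + 2 - 2 * (real d)\<^sup>2)" (is "_ \<le> ?D")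
      proof -
        \<comment> \<open>The first factor of the denominator is at least 2 and compensates for the
          half lost in \<open>half\<close>.\<close>
        have "2 * (real d * real n / 2) \<le> ?D" using half dn by (intro mult_mono) auto
        then show ?thesis by simp
      qed
      have "(real d * real ?x - real (0 + 2 * i))\<^sup>2 / ?D \<le> (real d * real M)\<^sup>2 / (real d * real n)"
        using num den dn by (intro frac_le) auto
      also have "\<dots> = real d * (real M)\<^sup>2 / real n" using d by (simp add: power2_eq_square)
      also have "\<dots> \<le> ?b / real n" by (intro divide_right_mono) auto
      finally show "0 \<le> (real d * real ?x - real (0 + 2 * i))\<^sup>2 / ?D \<and>
        (real d * real ?x - real (0 + 2 * i))\<^sup>2 / ?D \<le> ?b / real n"
        using den dn by (intro conjI divide_nonneg_nonneg) auto
    qed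
    finally show ?thesis by (simp add: mult_left_mono)
  qed
  have "real (card (dense_small n d M)) \<le> (\<Sum>a\<in>{..M}. real (n choose a) * (?N * (?b / real n) ^ (a + 1)))"
    unfolding dense_small_def
    by (intro card_regular_union_bound[where d = d] regular_with_arcs_ge_subset p) auto
  also have "\<dots> \<le> (\<Sum>a\<in>{..M}. ?N * (?b ^ (M + 1) / real n))"
  proof (rule sum_mono)
    fix a assume a: "a \<in> {..M}"
    then have "n choose a \<le> n ^ a" using n by (intro binomial_le_pow) auto
    then have "real (n choose a) \<le> real n ^ a" using of_nat_mono[of "n choose a" "n ^ a"] by simp
    then have "real (n choose a) * (?N * (?b / real n) ^ (a + 1)) \<le> real n ^ a * (?N * (?b / real n) ^ (a + 1))"
      by (intro mult_right_mono) auto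
    also have "\<dots> = ?N * (?b ^ (a + 1) / real n)"
      using n0 by (simp add: power_divide)
    also have "\<dots> \<le> ?N * (?b ^ (M + 1) / real n)"
      using a by (intro mult_left_mono divide_right_mono power_increasing) auto
    finally show "real (n choose a) * (?N * (?b / real n) ^ (a + 1)) \<le> ?N * (?b ^ (M + 1) / real n)" .
  qed
  also have "\<dots> = (real M + 1) * ?b ^ (M + 1) / real n * ?N" by simp
  finally show ?thesis .
qed

section \<open>Exponential estimates for switching ratios\<close>

lemma one_minus_le_exp:
  fixes s :: real
  assumes "0 \<le> s" shows "1 - s \<le> (1 + s) * exp (- 2 * s)"
proof -
  \<comment> \<open>For \<open>s < 1\<close> the claim is
    \<open>(1 - s) / (1 + s) \<le> exp (- 2 * s)\<close>, that is, \<open>s \<le> artanh s\<close>.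
    The difference \<open>f\<close> vanishes at 0 and is nondecreasing.\<close>
  define f where "f = (\<lambda>s::real. (1 + s) * exp (- 2 * s) - (1 - s))"
  have "f 0 \<le> f s"
  proof (rule DERIV_nonneg_imp_nondecreasing[OF assms])
    fix x :: real assume x: "0 \<le> x"
    have "DERIV f x :> 1 - (1 + 2 * x) * exp (- 2 * x)"
      unfolding f_def by (auto intro!: derivative_eq_intros simp: algebra_simps)
    moreover have "(1 + 2 * x) * exp (- 2 * x) \<le> exp (2 * x) * exp (- 2 * x)"
      by (intro mult_right_mono exp_ge_add_one_self) auto
    then have "0 \<le> 1 - (1 + 2 * x) * exp (- 2 * x)" by (simp add: exp_minus)
    ultimately show "\<exists>y. DERIV f x :> y \<and> 0 \<le> y" by blast
  qed
  then show ?thesis by (simp add: f_def)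
qed

lemma exp_le_one_minus:
  fixes y :: real
  assumes "0 \<le> y" "y \<le> 1 / 2" shows "exp (- 2 * y) \<le> 1 - y"
proof -
  have "0 \<le> y * (1 - 2 * y)" using assms by simp
  then have "1 \<le> (1 + 2 * y) * (1 - y)" by (simp add: algebra_simps)
  also have "\<dots> \<le> exp (2 * y) * (1 - y)"
    using assms by (intro mult_right_mono exp_ge_add_one_self) auto
  finally show ?thesis by (simp add: exp_minus field_simps)
qed

text \<open>The factor in \<open>card_regular_with_arcs_ge_prod\<close> at distance \<open>s\<close> (relative to \<open>D * a / 2\<close>)
  above the mean of the balanced case.\<close>

lemma switching_ratio_le:
  fixes D a n t s :: real
  assumes "0 < D" "0 < a" "2 * a \<le> n" "16 * D \<le> n" "0 \<le> s"
    and t: "D * a / 2 * (1 + s) \<le> t" "t \<le> D * a"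
  shows "(D * a - t)\<^sup>2 / ((t + 2) * (D * n - 2 * D * a + t + 2 - 2 * D\<^sup>2)) \<le>
    a / (n - a) * exp (- 4 * s) * exp (16 * D / n)"
proof -
  define h where "h = D * a / 2"
  have h0: "0 < h" using assms by (simp add: h_def)
  have n0: "0 < n" using assms by linarith
  have "h * (1 + s) \<le> h * 2" using t by (simp add: h_def)
  then have s1: "s \<le> 1" using h0 by simp
  \<comment> \<open>Like the bound inside \<open>A\<close>, this carries a factor
    \<open>1 + s\<close>; it bounds the pairs outside \<open>A\<close> from below because
    \<open>2 * a \<le> n\<close> and \<open>s \<le> 1\<close>. The ratio thus becomes
    \<open>a / (n - a)\<close> times the square of \<open>(1 - s) / (1 + s)\<close>, up to the
    forbidden switches.\<close>
  define Z where "Z = D * (n - a) / 2 * (1 + s)"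
  have "0 \<le> D * (n - 2 * a) * (1 - s)" using assms s1 by auto
  moreover have "D * n - 2 * D * a + h * (1 + s) - Z = D * (n - 2 * a) * (1 - s) / 2"
    by (simp add: Z_def h_def field_simps)
  ultimately have Z1: "Z \<le> D * n - 2 * D * a + t + 2" using t by (simp add: h_def)
  have "D * n / 4 \<le> D * (n - a) / 2 * 1" using assms by simp
  also have "\<dots> \<le> Z" unfolding Z_def using assms by (intro mult_left_mono) auto
  finally have Z2: "D * n / 4 \<le> Z" .
  \<comment> \<open>The forbidden switches, counted by \<open>2 * D\<^sup>2\<close>, cost at most a
    factor \<open>1 - 8 * D / n\<close>, which \<open>16 * D \<le> n\<close> lets be bounded below
    by an exponential.\<close>
  then have "D * n / 4 * (8 * D / n) \<le> Z * (8 * D / n)"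
    using assms n0 by (intro mult_right_mono) auto
  then have "2 * D\<^sup>2 \<le> Z * (8 * D / n)" using n0 by (simp add: power2_eq_square)
  then have Z3: "Z * (1 - 8 * D / n) \<le> D * n - 2 * D * a + t + 2 - 2 * D\<^sup>2"
    using Z1 by (simp add: right_diff_distrib)
  have Zpos: "0 < Z" using Z2 assms n0 by (meson divide_pos_pos mult_pos_pos less_le_trans zero_less_numeral)
  have e: "exp (- (16 * D / n)) \<le> 1 - 8 * D / n"
    using exp_le_one_minus[of "8 * D / n"] assms n0 by (simp add: field_simps)
  define W where "W = h * (1 + s) * (Z * exp (- (16 * D / n)))"
  have Wpos: "0 < W" using h0 Zpos assms by (simp add: W_def)
  have "Z * exp (- (16 * D / n)) \<le> D * n - 2 * D * a + t + 2 - 2 * D\<^sup>2"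
    using mult_left_mono[OF e, of Z] Zpos Z3 by linarith
  moreover have "0 \<le> h * (1 + s)" using h0 assms by simp
  then have "0 \<le> t" using t(1) unfolding h_def by linarith
  ultimately have den: "W \<le> (t + 2) * (D * n - 2 * D * a + t + 2 - 2 * D\<^sup>2)"
    unfolding W_def using t h0 Zpos assms by (intro mult_mono) (simp_all add: h_def)
  have "D * a - t \<le> h * (1 - s)" using t by (simp add: h_def algebra_simps)
  also have "\<dots> \<le> h * ((1 + s) * exp (- 2 * s))"
    using h0 one_minus_le_exp[OF assms(5)] by (intro mult_left_mono) auto
  finally have "(D * a - t)\<^sup>2 \<le> (h * ((1 + s) * exp (- 2 * s)))\<^sup>2"
    using t by (intro power_mono) auto
  then have "(D * a - t)\<^sup>2 / ((t + 2) * (D * n - 2 * D * a + t + 2 - 2 * D\<^sup>2)) \<le>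
      (h * ((1 + s) * exp (- 2 * s)))\<^sup>2 / W"
    using den Wpos by (intro frac_le) auto
  also have "\<dots> = a / (n - a) * (exp (- 2 * s))\<^sup>2 / exp (- (16 * D / n))"
  proof -
    have "(h * (u * x))\<^sup>2 / (h * u * (D * m / 2 * u * y)) = a / m * x\<^sup>2 / y"
      if "u \<noteq> 0" "m \<noteq> 0" "y \<noteq> 0" for u m x y :: real
      using that assms(1,2) by (simp add: h_def power2_eq_square field_simps)
    from this[of "1 + s" "n - a" "exp (- (16 * D / n))" "exp (- 2 * s)"] show ?thesis
      using assms by (simp add: W_def Z_def)
  qed
  also have "(exp (- 2 * s))\<^sup>2 = exp (- 4 * s)" by (simp flip: exp_double)
  also have "a / (n - a) * exp (- 4 * s) / exp (- (16 * D / n)) =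
      a / (n - a) * exp (- 4 * s) * exp (16 * D / n)"
    by (simp add: exp_minus divide_inverse)
  finally show ?thesis .
qed

text \<open>The factor of index \<open>i\<close> lies at relative distance at least
  \<open>s = 4 * i / (D * a)\<close>. Its exponent \<open>16 * i / (D * a)\<close> is linear in
  \<open>i\<close>, so the product decays like a Gaussian in \<open>j\<close>.\<close>

lemma switching_prod_le:
  fixes D a n t :: real and j :: nat
  assumes "0 < D" "0 < a" "2 * a \<le> n" "16 * D \<le> n"
    and t: "D * a / 2 \<le> t" "t + 2 * real j \<le> D * a + 2"
  shows "(\<Prod>i<j. (D * a - (t + 2 * real i))\<^sup>2 /
      ((t + 2 * real i + 2) * (D * n - 2 * D * a + (t + 2 * real i) + 2 - 2 * D\<^sup>2))) \<le>
    (a / (n - a)) ^ j * exp (- (8 * real j * (real j - 1) / (D * a))) * exp (16 * D / n * real j)"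
proof -
  have pos: "0 < D * n - 2 * D * a + t + 2 - 2 * D\<^sup>2"
  proof -
    have "D * (2 * a) \<le> D * n" "D * (16 * D) \<le> D * n" using assms by (auto intro: mult_left_mono)
    moreover have "0 < D * n" using assms by simp
    ultimately show ?thesis using t by (simp add: power2_eq_square)
  qed
  have "(\<Prod>i<j. (D * a - (t + 2 * real i))\<^sup>2 /
      ((t + 2 * real i + 2) * (D * n - 2 * D * a + (t + 2 * real i) + 2 - 2 * D\<^sup>2))) \<le>
    (\<Prod>i<j. a / (n - a) * exp (- (16 / (D * a)) * real i) * exp (16 * D / n))"
  proof (rule prod_mono, intro conjI)
    fix i assume i: "i \<in> {..<j}"
    have "0 \<le> t" using assms t by (smt (verit) divide_nonneg_nonneg mult_nonneg_nonneg)
    then show "0 \<le> (D * a - (t + 2 * real i))\<^sup>2 /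
      ((t + 2 * real i + 2) * (D * n - 2 * D * a + (t + 2 * real i) + 2 - 2 * D\<^sup>2))"
      using pos by (intro divide_nonneg_nonneg mult_nonneg_nonneg) auto
    have "D * a / 2 * (1 + 4 * real i / (D * a)) = D * a / 2 + 2 * real i"
      using assms by (simp add: field_simps)
    then have "(D * a - (t + 2 * real i))\<^sup>2 /
      ((t + 2 * real i + 2) * (D * n - 2 * D * a + (t + 2 * real i) + 2 - 2 * D\<^sup>2)) \<le>
      a / (n - a) * exp (- 4 * (4 * real i / (D * a))) * exp (16 * D / n)"
      using i assms by (intro switching_ratio_le) auto
    then show "(D * a - (t + 2 * real i))\<^sup>2 /
      ((t + 2 * real i + 2) * (D * n - 2 * D * a + (t + 2 * real i) + 2 - 2 * D\<^sup>2)) \<le>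
      a / (n - a) * exp (- (16 / (D * a)) * real i) * exp (16 * D / n)"
      by simp
  qed
  also have "\<dots> = (a / (n - a)) ^ j * exp (\<Sum>i<j. - (16 / (D * a)) * real i) * exp (16 * D / n * real j)"
    by (simp only: prod.distrib prod_constant card_lessThan exp_sum finite_lessThan exp_of_nat2_mult)
  also have "(\<Sum>i<j. - (16 / (D * a)) * real i) = - (16 / (D * a)) * (real j * (real j - 1) / 2)"
  proof -
    have "(\<Sum>i<j. real i) = real j * (real j - 1) / 2"
      by (induction j) (auto simp: field_simps)
    then show ?thesis by (simp only: sum_distrib_left[symmetric])
  qed
  also have "- (16 / (D * a)) * (real j * (real j - 1) / 2) = - (8 * real j * (real j - 1) / (D * a))"
    by simp
  finally show ?thesis .
qed

section \<open>The union bound for large sets\<close>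

lemma power_self_le_fact_exp: "real a ^ a \<le> fact a * exp (real a)"
proof -
  \<comment> \<open>One term of the exponential series is at most its sum.\<close>
  have "real a ^ a /\<^sub>R fact a \<le> exp (real a)"
    using sum_le_suminf[OF summable_exp_generic[of "real a"], of "{a}"]
    by (simp add: exp_def)
  then show ?thesis by (simp add: field_simps)
qed

lemma binomial_le_exp_power:
  assumes "0 < a"
  shows "real (n choose a) \<le> (exp 1 * real n / real a) ^ a"
proof (cases "a \<le> n")
  case True
  have "(n choose a) * fact a \<le> n ^ a"
    using binomial_fact_pow by simp
  then have "real (n choose a) * fact a \<le> real n ^ a"
    by (metis of_nat_fact of_nat_le_iff of_nat_mult of_nat_power)
  then have "real (n choose a) * fact a * exp (real a) \<le> real n ^ a * exp (real a)"
    by (intro mult_right_mono) auto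
  moreover have "real (n choose a) * real a ^ a \<le> real (n choose a) * (fact a * exp (real a))"
    by (intro mult_left_mono power_self_le_fact_exp) auto
  ultimately have "real (n choose a) * real a ^ a \<le> real n ^ a * exp (real a)" by (metis mult.assoc order_trans)
  then show ?thesis using assms
    by (simp add: power_divide power_mult_distrib field_simps exp_of_nat_mult[symmetric])
next
  case False
  then show ?thesis by (simp add: binomial_eq_0)
qed

text \<open>The loss of \<open>d\<close> squared allows for the edges from \<open>A\<close> to fewer
  than \<open>d\<close> separating vertices. From size \<open>40 * d\<^sup>2\<close> on, this is
  small compared with \<open>sqrt d * card A\<close>.\<close>

definition dense_large :: "nat \<Rightarrow> nat \<Rightarrow> nat graph set" where
  "dense_large n d = {G. \<exists>A. A \<subseteq> {1..n} \<and> card A \<in> {40 * d\<^sup>2..n div 2} \<and>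
     G \<in> {G \<in> regular_graphs n d. (real d / 2 + sqrt (real d)) * real (card A) - (real d)\<^sup>2
            \<le> real (card (arcs (edges G) A A))}}"

lemma card_dense_set:
  assumes A: "A \<subseteq> {1..n}" and d: "400 \<le> d" and a: "40 * d\<^sup>2 \<le> card A" "2 * card A \<le> n"
    and n: "16 * d \<le> n"
  shows "real (card {G \<in> regular_graphs n d. (real d / 2 + sqrt (real d)) * real (card A) - (real d)\<^sup>2
            \<le> real (card (arcs (edges G) A A))}) \<le>
    real (card (regular_graphs n d)) * ((real (card A) / (real n - real (card A))) ^ (2 * card A) *
      exp (- (7 / 4 * real (card A))) * exp (16 * (real d)\<^sup>2))"
proof -
  define x where "x = sqrt (real d)"
  define D where "D = real d"
  define r where "r = real (card A)"
  define N where "N = real n"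
  \<comment> \<open>The starting level is \<open>d * card A / 2\<close>, rounded up.\<close>
  define t where "t = (d * card A + 1) div 2"
  \<comment> \<open>These \<open>j\<close> steps climb about \<open>19 / 20\<close> of the excess
    \<open>x * r\<close>; the remaining twentieth covers the loss of \<open>d\<close> squared and
    the roundings.\<close>
  define j where "j = nat \<lceil>19 / 40 * x * r\<rceil>"
  have D400: "400 \<le> D" using d by (simp add: D_def)
  have xx: "x * x = D" by (simp add: x_def D_def)
  have x20: "20 \<le> x" unfolding x_def using d by (intro real_le_rsqrt) simp
  have "real (40 * d\<^sup>2) \<le> r" using a(1) unfolding r_def by (rule of_nat_mono)
  then have rD: "40 * (D * D) \<le> r" by (simp add: D_def power2_eq_square)
  have "400 * 400 \<le> D * D" using D400 by (intro mult_mono) auto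
  then have r1: "1 \<le> r" "0 < r" using rD by linarith+
  have "real (2 * card A) \<le> N" using a(2) unfolding N_def by (rule of_nat_mono)
  then have rN: "2 * r \<le> N" by (simp add: r_def)
  have "real (16 * d) \<le> N" using n unfolding N_def by (rule of_nat_mono)
  then have DN: "16 * D \<le> N" by (simp add: D_def)
  define y where "y = x * r"
  have yr: "20 * r \<le> y" unfolding y_def using x20 r1 by (intro mult_right_mono) auto
  have "20 * y \<le> x * y" using x20 yr r1 by (intro mult_right_mono) auto
  then have Dr: "20 * y \<le> D * r" by (simp add: y_def xx[symmetric])
  have j: "19 / 40 * y \<le> real j" "real j \<le> 19 / 40 * y + 1"
    using yr r1 by (auto simp: j_def y_def mult.assoc intro: order_trans[OF _ real_nat_ceiling_ge] of_nat_ceiling)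
  have "2 * t \<le> d * card A + 1" "d * card A \<le> 2 * t" unfolding t_def by linarith+
  then have "real (2 * t) \<le> real (d * card A + 1)" "real (d * card A) \<le> real (2 * t)"
    by (simp_all only: of_nat_le_iff)
  then have t: "real t \<le> D * r / 2 + 1 / 2" "D * r / 2 \<le> real t" by (simp_all add: D_def r_def)
  have tj: "real t + 2 * real j \<le> D * r + 2" using t j Dr yr r1 by linarith
  then have "real (t + 2 * j) \<le> real (d * card A + 2)" by (simp add: D_def r_def)
  then have tj': "t + 2 * j \<le> d * card A + 2" by (simp only: of_nat_le_iff)
  have pos: "0 < D * N - 2 * D * r + real t + 2 - 2 * D\<^sup>2"
  proof -
    have "D * (2 * r) \<le> D * N" "D * (16 * D) \<le> D * N" using rN DN D400 by (auto intro!: mult_left_mono)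
    moreover have "0 < D * N" using rN D400 r1 by simp
    ultimately show ?thesis using t by (simp add: power2_eq_square)
  qed
  have "{G \<in> regular_graphs n d. (D / 2 + x) * r - D\<^sup>2 \<le> real (card (arcs (edges G) A A))}
      \<subseteq> regular_with_arcs_ge n d A (t + 2 * j)"
  proof
    fix G assume G: "G \<in> {G \<in> regular_graphs n d. (D / 2 + x) * r - D\<^sup>2 \<le> real (card (arcs (edges G) A A))}"
    have "real (t + 2 * j) \<le> D * r / 2 + 19 / 20 * y + 5 / 2" using t j by simp
    also have "\<dots> \<le> D * r / 2 + y - D * D" using yr rD r1 \<open>400 * 400 \<le> D * D\<close> by linarith
    also have "\<dots> = (D / 2 + x) * r - D\<^sup>2" by (simp add: y_def power2_eq_square algebra_simps)
    also have "\<dots> \<le> real (card (arcs (edges G) A A))" using G by simp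
    finally have "t + 2 * j \<le> card (arcs (edges G) A A)" by (simp only: of_nat_le_iff)
    with G show "G \<in> regular_with_arcs_ge n d A (t + 2 * j)" by (simp add: regular_with_arcs_ge_def)
  qed
  then have "card {G \<in> regular_graphs n d. (D / 2 + x) * r - D\<^sup>2 \<le> real (card (arcs (edges G) A A))}
      \<le> card (regular_with_arcs_ge n d A (t + 2 * j))"
    by (intro card_mono finite_subset[OF regular_with_arcs_ge_subset finite_regular_graphs])
  then have "real (card {G \<in> regular_graphs n d. (D / 2 + x) * r - D\<^sup>2 \<le> real (card (arcs (edges G) A A))})
      \<le> real (card (regular_with_arcs_ge n d A (t + 2 * j)))" by (rule of_nat_mono)
  also have "\<dots> \<le> real (card (regular_graphs n d)) * (\<Prod>i<j. (D * r - (real t + 2 * real i))\<^sup>2 /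
      ((real t + 2 * real i + 2) * (D * N - 2 * D * r + (real t + 2 * real i) + 2 - 2 * D\<^sup>2)))"
    using card_regular_with_arcs_ge_prod[OF A tj'] pos unfolding D_def r_def N_def by simp
  also have "\<dots> \<le> real (card (regular_graphs n d)) * ((r / (N - r)) ^ (2 * card A) *
      exp (- (7 / 4 * r)) * exp (16 * D\<^sup>2))"
  proof (intro mult_left_mono)
    have "(\<Prod>i<j. (D * r - (real t + 2 * real i))\<^sup>2 /
      ((real t + 2 * real i + 2) * (D * N - 2 * D * r + (real t + 2 * real i) + 2 - 2 * D\<^sup>2))) \<le>
      (r / (N - r)) ^ j * exp (- (8 * real j * (real j - 1) / (D * r))) * exp (16 * D / N * real j)"
      by (rule switching_prod_le) (use D400 r1 rN DN t tj in auto)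
    also have "\<dots> \<le> (r / (N - r)) ^ (2 * card A) * exp (- (7 / 4 * r)) * exp (16 * D\<^sup>2)"
    proof (intro mult_mono)
      \<comment> \<open>Since \<open>x\<close> is at least 20, there are more than
        \<open>2 * card A\<close> factors \<open>r / (N - r)\<close>; each is at most 1, and only
        this many are kept.\<close>
      have "real (2 * card A) \<le> real j" using j yr by (simp add: r_def)
      then have "2 * card A \<le> j" by (simp only: of_nat_le_iff)
      then show "(r / (N - r)) ^ j \<le> (r / (N - r)) ^ (2 * card A)"
        using rN r1 by (intro power_decreasing) auto
      \<comment> \<open>Lowering \<open>19 / 40\<close> to \<open>47 / 100\<close> absorbs the
        \<open>- 1\<close>. The product is \<open>893 / 4000\<close>, and eight times that exceeds
        \<open>7 / 4\<close>.\<close>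
      have "19 / 40 * y * (47 / 100 * y) \<le> real j * (real j - 1)"
        using j yr rD D400 r1 \<open>400 * 400 \<le> D * D\<close> by (intro mult_mono) auto
      moreover have "y * y = D * (r * r)" by (simp add: y_def xx[symmetric])
      ultimately have "893 / 4000 * (D * (r * r)) \<le> real j * (real j - 1)" by simp
      moreover have "0 \<le> D * (r * r)" using D400 r1 by simp
      ultimately have "7 / 4 * (D * (r * r)) \<le> 8 * real j * (real j - 1)" by linarith
      then have "7 / 4 * r \<le> 8 * real j * (real j - 1) / (D * r)"
        using D400 r1 by (simp add: field_simps)
      then show "exp (- (8 * real j * (real j - 1) / (D * r))) \<le> exp (- (7 / 4 * r))" by simp
      \<comment> \<open>The accumulated correction is bounded independently of \<open>N\<close>,
        because \<open>j\<close> is at most \<open>D * N\<close>.\<close>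
      have "real j \<le> D * r" using j Dr yr r1 by linarith
      also have "\<dots> \<le> D * N" using D400 rN r1 by (intro mult_left_mono) auto
      finally have "16 * D / N * real j \<le> 16 * D / N * (D * N)"
        using D400 rN r1 by (intro mult_left_mono) auto
      also have "\<dots> = 16 * D\<^sup>2" using rN r1 by (simp add: power2_eq_square)
      finally show "exp (16 * D / N * real j) \<le> exp (16 * D\<^sup>2)" by simp
    qed (use rN r1 in auto)
    finally show "(\<Prod>i<j. (D * r - (real t + 2 * real i))\<^sup>2 /
      ((real t + 2 * real i + 2) * (D * N - 2 * D * r + (real t + 2 * real i) + 2 - 2 * D\<^sup>2))) \<le> \<dots>" .
  qed simp
  finally show ?thesis by (simp add: D_def x_def r_def N_def)
qed

text \<open>The margin in the union bound at the worst size \<open>a = n / 2\<close>: there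
  \<open>n * a / (n - a)\<^sup>2\<close> is 2, while the binomial factor \<open>exp 1\<close> and
  the decay \<open>exp (- (7 / 4))\<close> combine to \<open>exp (- (3 / 4))\<close>.\<close>

lemma two_exp_neg_less_1: "2 * exp (- (3 / 4)) < (1 :: real)"
proof -
  have "1 + 3 / 4 + (3 / 4)\<^sup>2 / 2 \<le> exp (3 / 4 :: real)" by (rule exp_lower_Taylor_quadratic) simp
  then have "2 < exp (3 / 4 :: real)" by (simp add: power2_eq_square)
  then show ?thesis by (simp add: exp_minus field_simps)
qed

text \<open>The contribution of size \<open>a\<close> is at most a constant times
  \<open>(c * (2 * a / n)) ^ a\<close> with \<open>c < 1\<close>, relative to the number of regular
  graphs. One factor \<open>2 * a / n\<close> gives the decay in \<open>n\<close>, and the powers of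
  \<open>c\<close> make the sum over \<open>a\<close> converge.\<close>

lemma card_dense_large:
  assumes d: "400 \<le> d" and n: "16 * d \<le> n"
  shows "real (card (dense_large n d)) \<le>
    2 * exp (16 * (real d)\<^sup>2) / (1 - 2 * exp (- (3 / 4)))\<^sup>2 / real n * real (card (regular_graphs n d))"
proof -
  let ?N = "real (card (regular_graphs n d))"
  let ?K = "exp (16 * (real d)\<^sup>2)"
  let ?I = "{40 * d\<^sup>2..n div 2}"
  define c :: real where "c = 2 * exp (- (3 / 4))"
  have c: "0 < c" "c < 1" using two_exp_neg_less_1 by (simp_all add: c_def)
  have n0: "0 < real n" using d n by simp
  have "real (card (dense_large n d)) \<le> (\<Sum>a\<in>?I. real (n choose a) *
      (?N * ((real a / (real n - real a)) ^ (2 * a) * exp (- (7 / 4 * real a)) * ?K)))"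
    unfolding dense_large_def
  proof (rule card_regular_union_bound[where d = d])
    fix A :: "nat set" assume "A \<subseteq> {1..n}" "card A \<in> ?I"
    then show "real (card {G \<in> regular_graphs n d. (real d / 2 + sqrt (real d)) * real (card A) - (real d)\<^sup>2
            \<le> real (card (arcs (edges G) A A))}) \<le>
      ?N * ((real (card A) / (real n - real (card A))) ^ (2 * card A) *
      exp (- (7 / 4 * real (card A))) * exp (16 * (real d)\<^sup>2))"
      using d n by (intro card_dense_set) auto
  qed auto
  also have "\<dots> \<le> (\<Sum>a\<in>?I. ?N * ?K * (2 / real n) * (real (Suc a) * c ^ a))"
  proof (rule sum_mono)
    fix a assume a: "a \<in> ?I"
    have "1 \<le> d\<^sup>2" using d by simp
    with a have a0: "0 < a" and "2 * a \<le> n" by auto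
    then have "real (2 * a) \<le> real n" by (simp only: of_nat_le_iff)
    then have an: "2 * real a \<le> real n" by simp
    define b where "b = real a / (real n - real a)"
    have b0: "0 \<le> b" using an n0 by (simp add: b_def)
    have eq: "exp 1 * real n / real a * b\<^sup>2 * exp (- (7 / 4)) = exp (- (3 / 4)) * (real n * real a / (real n - real a)\<^sup>2)"
    proof -
      have "exp 1 * exp (- (7 / 4)) = exp (- (3 / 4) :: real)" by (simp flip: exp_add)
      moreover have "real n / real a * b\<^sup>2 = real n * real a / (real n - real a)\<^sup>2"
        using a0 by (simp add: b_def power2_eq_square)
      moreover have "exp 1 * real n / real a * b\<^sup>2 * exp (- (7 / 4)) =
          exp 1 * exp (- (7 / 4)) * (real n / real a * b\<^sup>2)" by simp
      ultimately show ?thesis by simp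
    qed
    have "real n * real a / (real n - real a)\<^sup>2 \<le> real n * real a / (real n / 2)\<^sup>2"
      using an n0 by (intro divide_left_mono power_mono mult_nonneg_nonneg) auto
    also have "\<dots> = 2 * (2 * real a / real n)" using n0 by (simp add: power2_eq_square)
    finally have le: "real n * real a / (real n - real a)\<^sup>2 \<le> 2 * (2 * real a / real n)" .
    have base: "exp 1 * real n / real a * b\<^sup>2 * exp (- (7 / 4)) \<le> c * (2 * real a / real n)"
      unfolding eq c_def using mult_left_mono[OF le, of "exp (- (3 / 4))"] by (simp only: mult_ac exp_ge_zero)
    have expa: "exp (- (7 / 4 * real a)) = exp (- (7 / 4)) ^ a"
      using exp_of_nat2_mult[of "- (7 / 4)" a] by simp
    have "real (n choose a) * (b ^ (2 * a) * exp (- (7 / 4)) ^ a) \<le>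
        (exp 1 * real n / real a) ^ a * (b ^ (2 * a) * exp (- (7 / 4)) ^ a)"
      using b0 by (intro mult_right_mono binomial_le_exp_power a0) auto
    also have "\<dots> = (exp 1 * real n / real a * b\<^sup>2 * exp (- (7 / 4))) ^ a"
      by (simp only: power_mult_distrib power_mult mult.assoc)
    also have "\<dots> \<le> (c * (2 * real a / real n)) ^ a"
      using b0 by (intro power_mono base) auto
    also have "\<dots> = c ^ a * (2 * real a / real n) ^ a" by (rule power_mult_distrib)
    \<comment> \<open>All but one of the factors \<open>2 * a / n\<close> are dropped; they are at
      most 1.\<close>
    also have "\<dots> \<le> c ^ a * (2 * real a / real n) ^ 1"
      using an n0 a0 c by (intro mult_left_mono power_decreasing) auto
    also have "\<dots> \<le> 2 / real n * (real (Suc a) * c ^ a)"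
      using c n0 by (simp add: field_simps)
    finally have "real (n choose a) * (b ^ (2 * a) * exp (- (7 / 4 * real a))) \<le> 2 / real n * (real (Suc a) * c ^ a)"
      unfolding expa .
    then have "?N * ?K * (real (n choose a) * (b ^ (2 * a) * exp (- (7 / 4 * real a)))) \<le>
        ?N * ?K * (2 / real n * (real (Suc a) * c ^ a))"
      by (intro mult_left_mono) auto
    then show "real (n choose a) *
      (?N * ((real a / (real n - real a)) ^ (2 * a) * exp (- (7 / 4 * real a)) * ?K)) \<le>
      ?N * ?K * (2 / real n) * (real (Suc a) * c ^ a)"
      unfolding b_def by (simp only: mult_ac)
  qed
  also have "\<dots> = ?N * ?K * (2 / real n) * (\<Sum>a\<in>?I. real (Suc a) * c ^ a)"
    by (rule sum_distrib_left[symmetric])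
  also have "\<dots> \<le> ?N * ?K * (2 / real n) * (1 / (1 - c)\<^sup>2)"
  proof (intro mult_left_mono)
    have s: "(\<lambda>a. real (Suc a) * c ^ a) sums (1 / (1 - c)\<^sup>2)"
      using geometric_deriv_sums[of c] c by simp
    have "(\<Sum>a\<in>?I. real (Suc a) * c ^ a) \<le> (\<Sum>a. real (Suc a) * c ^ a)"
      using s c by (intro sum_le_suminf) (auto simp: sums_iff)
    then show "(\<Sum>a\<in>?I. real (Suc a) * c ^ a) \<le> 1 / (1 - c)\<^sup>2"
      using s by (simp add: sums_iff)
  qed auto
  finally show ?thesis by (simp add: c_def mult_ac)
qed

section \<open>Resilience of regular graphs\<close>

text \<open>A failure yields sets \<open>A\<close> and \<open>S\<close> such that every vertex of
  \<open>A\<close> has at least \<open>D = d - max_degree H\<close> neighbours in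
  \<open>A \<union> S\<close>, where \<open>D\<close> is at least \<open>k\<close> and at least
  \<open>d / 2 + sqrt d\<close>. Large \<open>A\<close> contradicts \<open>large\<close>, bounded
  \<open>A\<close> contradicts \<open>small\<close>.\<close>

lemma vertex_connected_after_deletion:
  assumes G: "G \<in> regular_graphs n d" and d: "400 \<le> d" and H: "spanning_subgraph H G"
    and k: "1 \<le> k" "k \<le> n"
    and r: "max_degree H + k \<le> d" "real (max_degree H) \<le> real d / 2 - sqrt (real d)"
    and small: "G \<notin> dense_small n d (40 * d\<^sup>2 + d)" and large: "G \<notin> dense_large n d"
  shows "delete_edges G H \<in> vertex_connected k"
proof (rule ccontr)
  assume nc: "delete_edges G H \<notin> vertex_connected k"
  let ?E = "edges G"
  note V = regular_graphsD(1)[OF G] and sG = regular_graphsD(2)[OF G]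
  have reg: "vdegree G v = d" if "v \<in> verts G" for v
    using that regular_graphsD(3)[OF G] V by simp
  obtain A S where A: "A \<noteq> {}" "A \<subseteq> verts G" "S \<subseteq> verts G" "A \<inter> S = {}" "card S = k - 1"
      "2 * card A \<le> card (verts G)"
      and deg: "\<And>v. v \<in> A \<Longrightarrow> d \<le> card (nbrs ?E v (A \<union> S)) + max_degree H"
    using separation_of_not_vertex_connected[OF sG H reg k(1) _ nc] k V by auto
  have AV: "A \<subseteq> {1..n}" "S \<subseteq> {1..n}" using A V by auto
  have fin: "finite A" "finite S" using AV by (auto intro: finite_subset)
  define D where "D = d - max_degree H"
  have Dk: "k \<le> D" using r(1) by (simp add: D_def)
  have D: "real d / 2 + sqrt (real d) \<le> real D" using r by (simp add: D_def of_nat_diff)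
  have sq: "0 \<le> sqrt (real d)" by simp
  have D5: "5 \<le> D" using D d sq by linarith
  have degD: "D \<le> card (nbrs ?E v (A \<union> S))" if "v \<in> A" for v
    using deg[OF that] by (simp add: D_def)
  have "(\<Sum>v\<in>A. D) \<le> (\<Sum>v\<in>A. card (nbrs ?E v (A \<union> S)))"
    by (intro sum_mono degD)
  also have "\<dots> = card (arcs ?E A A) + card (arcs ?E A S)"
    using fin A(4) card_arcs_Un_right[of A A S ?E] by (simp add: card_arcs)
  finally have sum: "D * card A \<le> card (arcs ?E A A) + card (arcs ?E A S)" by (simp add: mult.commute)
  show False
  proof (cases "40 * d\<^sup>2 \<le> card A")
    case True
    have "card (arcs ?E A S) = (\<Sum>v\<in>S. card (nbrs ?E v A))"
      using fin by (simp add: card_arcs_commute[of ?E A S] card_arcs)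
    also have "\<dots> \<le> (\<Sum>v\<in>S. d)"
    proof (rule sum_mono)
      fix v assume "v \<in> S"
      then have "card (nbrs ?E v {1..n}) = d" using AV regular_graphsD(4)[OF G] by blast
      then show "card (nbrs ?E v A) \<le> d" using card_nbrs_mono[OF AV(1), of ?E v] by simp
    qed
    also have "\<dots> \<le> d * d"
    proof -
      have "card S \<le> d" using A(5) r(1) by linarith
      then show ?thesis by simp
    qed
    finally have "D * card A \<le> card (arcs ?E A A) + d * d" using sum by simp
    then have "real (D * card A) \<le> real (card (arcs ?E A A) + d * d)" by (rule of_nat_mono)
    moreover have "(real d / 2 + sqrt (real d)) * real (card A) \<le> real D * real (card A)"
      using D by (rule mult_right_mono) simp
    ultimately have "(real d / 2 + sqrt (real d)) * real (card A) - (real d)\<^sup>2 \<le> real (card (arcs ?E A A))"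
      by (simp add: power2_eq_square)
    moreover have "card A \<in> {40 * d\<^sup>2..n div 2}" using True A(6) V by simp
    ultimately have "G \<in> dense_large n d" using G AV unfolding dense_large_def by blast
    with large show False ..
  next
    case False
    \<comment> \<open>The size limit accommodates \<open>A \<union> S\<close> as well as
      \<open>A\<close>.\<close>
    have few: "card (arcs ?E X X) \<le> 2 * card X + 1"
      if X: "X \<subseteq> {1..n}" and cX: "card X \<le> 40 * d\<^sup>2 + d" for X
    proof (rule ccontr)
      assume "\<not> ?thesis"
      then have "G \<in> regular_with_arcs_ge n d X (2 * card X + 2)"
        using G by (simp add: regular_with_arcs_ge_def)
      with X cX small show False unfolding dense_small_def by blast
    qed
    have cU: "card (A \<union> S) = card A + (k - 1)" using A(4,5) fin by (simp add: card_Un_disjoint)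
    have "card (arcs ?E A A) \<le> 2 * card A + 1" using False AV by (intro few) auto
    moreover have "card (arcs ?E (A \<union> S) (A \<union> S)) \<le> 2 * card (A \<union> S) + 1"
      using False AV r(1) cU by (intro few) auto
    moreover note card_arcs_self_Un[OF fin A(4), of ?E]
    \<comment> \<open>Adding the bounds for \<open>A\<close> and \<open>A \<union> S\<close> counts
      both the pairs inside \<open>A\<close> and those from \<open>A\<close> to \<open>S\<close>
      twice. Halving gives at most \<open>2 * card A + k\<close>.\<close>
    ultimately have bound: "D * card A \<le> 2 * card A + D"
      using sum cU k Dk by linarith
    have "card A \<noteq> 0" using A(1) fin by simp
    show False
    \<comment> \<open>A single vertex would need \<open>D \<ge> k\<close> neighbours among the
      \<open>k - 1\<close> vertices of \<open>S\<close>; for at least two vertices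
      \<open>bound\<close> forces \<open>D \<le> 4\<close>.\<close>
    proof (cases "card A = 1")
      case True
      then obtain v where v: "A = {v}" by (auto simp: card_1_singleton_iff)
      have "nbrs ?E v (A \<union> S) \<subseteq> S"
        using simple_graph_no_loop[OF sG, of v] by (auto simp: nbrs_def v)
      then have "card (nbrs ?E v (A \<union> S)) \<le> k - 1" using A(5) fin card_mono by metis
      moreover have "D \<le> card (nbrs ?E v (A \<union> S))" by (rule degD) (simp add: v)
      ultimately show False using Dk k by linarith
    next
      case False
      with \<open>card A \<noteq> 0\<close> have a2: "2 \<le> card A" by simp
      define D' where "D' = D - 2"
      have D': "D = D' + 2" using D5 by (simp add: D'_def)
      have "D' * 2 \<le> D' * card A" using a2 by (rule mult_le_mono2)
      moreover have "D' * card A + 2 * card A \<le> 2 * card A + D" using bound by (simp add: D' algebra_simps)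
      ultimately show False using D' D5 by linarith
    qed
  qed
qed

section \<open>Upper and lower bounds on the resilience\<close>

lemma local_resilience_le_star:
  assumes G: "G \<in> regular_graphs n d" and k: "1 \<le> k" "k \<le> d" "k < n"
  shows "local_resilience G (vertex_connected k) \<le> d - k + 1"
proof -
  let ?E = "edges G" and ?v = "1::nat"
  have v: "?v \<in> {1..n}" using k by simp
  let ?N = "nbrs ?E ?v {1..n}"
  \<comment> \<open>\<open>S\<close> consists of \<open>k - 1\<close> neighbours of one vertex; the
    witness is the star of its other \<open>d - k + 1\<close> edges.\<close>
  have "k - 1 \<le> card ?N" using regular_graphsD(4)[OF G v] k by simp
  then obtain S where S: "S \<subseteq> ?N" "card S = k - 1" "finite S"
    by (rule obtain_subset_with_card_n)
  have vS: "?v \<notin> S" using S simple_graph_no_loop[OF regular_graphsD(2)[OF G], of ?v] by (auto simp: nbrs_def)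
  have SV: "S \<subseteq> {1..n}" using S(1) nbrs_subset by (rule subset_trans)
  let ?B = "{1..n} - S - {?v}"
  have "card (insert ?v S) < card {1..n}"
    using card_insert_disjoint[OF S(3) vS] S(2) k by simp
  then have "insert ?v S \<noteq> {1..n}" by (metis less_irrefl)
  then have B: "?B \<noteq> {}" using SV v by blast
  show ?thesis
  proof (rule local_resilience_le_of_separation[where A = "{?v}" and B = ?B and S = S])
    show "simple_graph G" using G by (rule regular_graphsD)
    show "verts G = {?v} \<union> ?B \<union> S" using regular_graphsD(1)[OF G] SV v by blast
  next
    fix w assume w: "w \<in> {?v}"
    have "nbrs ?E w ?B \<subseteq> ?N - S" using w by (auto simp: nbrs_def)
    then have "card (nbrs ?E w ?B) \<le> card (?N - S)" by (intro card_mono) auto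
    also have "\<dots> = d - (k - 1)"
      using S regular_graphsD(4)[OF G v] by (simp add: card_Diff_subset)
    finally show "card (nbrs ?E w ?B) \<le> d - k + 1" using k by simp
  next
    fix w
    have "card (nbrs ?E w {?v}) \<le> card {?v}" by (intro card_mono nbrs_subset) simp
    then show "card (nbrs ?E w {?v}) \<le> d - k + 1" by simp
  qed (use S vS B in auto)
qed

text \<open>In a Stiebitz partition with inner degrees at least \<open>(d - 1) div 2\<close>, every
  vertex has at most \<open>d / 2 + 1\<close> neighbours across. Any \<open>k - 1\<close> vertices
  may then be removed as long as both sides survive.\<close>

lemma local_resilience_le_half:
  assumes G: "G \<in> regular_graphs n d" and k: "1 \<le> k" "k < n" and d: "3 \<le> d"
  shows "real (local_resilience G (vertex_connected k)) \<le> real d / 2 + 1"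
proof -
  let ?E = "edges G" and ?s = "(d - 1) div 2" and ?V = "{1..n}"
  note sG = regular_graphsD(2)[OF G]
  have s: "1 \<le> ?s" "2 * ?s + 1 \<le> d" using d by linarith+
  have "?V \<noteq> {}" using k by simp
  obtain A B where AB: "A \<union> B = ?V" "A \<inter> B = {}" and gA: "inner_degree_ge ?E ?s A" and gB: "inner_degree_ge ?E ?s B"
  proof (rule Stiebitz_partition[of ?V ?E ?s])
    fix v assume "v \<in> ?V"
    then show "2 * ?s + 1 \<le> card (nbrs ?E v ?V)" using regular_graphsD(4)[OF G] s by simp
  qed (use s \<open>?V \<noteq> {}\<close> simple_graph_no_loop[OF sG] in auto)
  have fin: "finite A" "finite B" using AB(1) by (metis finite_Un finite_atLeastAtMost)+
  \<comment> \<open>Protecting one vertex on each side keeps both sides nonempty after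
    \<open>S\<close> is removed.\<close>
  obtain a b where ab: "a \<in> A" "b \<in> B" using gA gB by (auto simp: inner_degree_ge_def)
  then have ab': "a \<in> ?V" "b \<in> ?V" "a \<noteq> b" using AB by blast+
  then have "card (?V - {a, b}) = n - 2" by (simp add: card_Diff_subset)
  then have "k - 1 \<le> card (?V - {a, b})" using k by simp
  then obtain S where S: "S \<subseteq> ?V - {a, b}" "card S = k - 1"
    by (rule obtain_subset_with_card_n)
  have cross: "card (nbrs ?E v Y) \<le> d - ?s"
    if XY: "X \<union> Y = ?V" "X \<inter> Y = {}" "finite X" "finite Y" and g: "inner_degree_ge ?E ?s X" and v: "v \<in> X" for X Y v
  proof -
    have "v \<in> ?V" using v XY by blast
    then have "d = card (nbrs ?E v (X \<union> Y))" unfolding XY(1) using regular_graphsD(4)[OF G] by simp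
    also have "\<dots> = card (nbrs ?E v X) + card (nbrs ?E v Y)" using XY by (intro card_nbrs_Un) auto
    finally have "d = card (nbrs ?E v X) + card (nbrs ?E v Y)" .
    moreover have "?s \<le> card (nbrs ?E v X)" using g v by (auto simp: inner_degree_ge_def)
    ultimately show ?thesis by linarith
  qed
  have "local_resilience G (vertex_connected k) \<le> d - ?s"
  proof (rule local_resilience_le_of_separation[where A = "A - S" and B = "B - S" and S = S])
    show "verts G = A - S \<union> (B - S) \<union> S" using regular_graphsD(1)[OF G] AB(1) S by blast
  next
    fix v assume "v \<in> A - S"
    then have "card (nbrs ?E v B) \<le> d - ?s" using AB fin gA by (intro cross[of A]) auto
    moreover have "card (nbrs ?E v (B - S)) \<le> card (nbrs ?E v B)" using fin by (intro card_nbrs_mono) auto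
    ultimately show "card (nbrs ?E v (B - S)) \<le> d - ?s" by linarith
  next
    fix v assume "v \<in> B - S"
    then have "card (nbrs ?E v A) \<le> d - ?s" using AB fin gB by (intro cross[of B]) auto
    moreover have "card (nbrs ?E v (A - S)) \<le> card (nbrs ?E v A)" using fin by (intro card_nbrs_mono) auto
    ultimately show "card (nbrs ?E v (A - S)) \<le> d - ?s" by linarith
  next
    show "A - S \<noteq> {}" "B - S \<noteq> {}" using ab S by blast+
  qed (use AB S sG in auto)
  then have "2 * local_resilience G (vertex_connected k) \<le> d + 2" using s d by linarith
  then have "real (2 * local_resilience G (vertex_connected k)) \<le> real (d + 2)" by (rule of_nat_mono)
  then show ?thesis by simp
qed

lemma local_resilience_bounds:
  assumes G: "G \<in> regular_graphs n d" and d: "400 \<le> d" "d < n"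
    and small: "G \<notin> dense_small n d (40 * d\<^sup>2 + d)" and large: "G \<notin> dense_large n d"
  shows "\<And>k. real d / 2 + sqrt (real d) \<le> real k \<Longrightarrow> k \<le> d \<Longrightarrow>
      real (local_resilience G (vertex_connected k)) = real d - real k + 1"
    and "\<And>k. 1 \<le> k \<Longrightarrow> real k < real d / 2 + sqrt (real d) \<Longrightarrow>
      real d / 2 - sqrt (real d) < real (local_resilience G (vertex_connected k)) \<and>
      real (local_resilience G (vertex_connected k))
        \<le> min (real d - real k + 1) (real d / 2 + 4 * sqrt (real d * ln (real d)))"
proof -
  \<comment> \<open>A subgraph attaining the resilience cannot satisfy the degree bounds of
    \<open>vertex_connected_after_deletion\<close>.\<close>
  have lower: "real d / 2 - sqrt (real d) < real (local_resilience G (vertex_connected k))"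
    if k: "1 \<le> k" "k \<le> d" "local_resilience G (vertex_connected k) + k \<le> d" for k
  proof (rule ccontr)
    assume le: "\<not> ?thesis"
    have kn: "k < n" using k d by simp
    then have "k < card (verts G)" using regular_graphsD(1)[OF G] by simp
    from local_resilience_attained[OF k(1) this]
    obtain H where H: "spanning_subgraph H G" "max_degree H = local_resilience G (vertex_connected k)"
      "delete_edges G H \<notin> vertex_connected k" by blast
    have "delete_edges G H \<in> vertex_connected k"
      by (rule vertex_connected_after_deletion[OF G d(1) H(1) k(1) _ _ _ small large])
        (use kn k le H(2) in auto)
    with H(3) show False ..
  qed
  {
    fix k assume k: "real d / 2 + sqrt (real d) \<le> real k" "k \<le> d"
    have "0 < real d / 2" "0 \<le> sqrt (real d)" using d by simp_all
    then have "0 < real k" using k(1) by linarith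
    then have k1: "1 \<le> k" by simp
    have "local_resilience G (vertex_connected k) \<le> d - k + 1"
      using local_resilience_le_star[OF G k1 k(2)] k d by simp
    \<comment> \<open>For such large \<open>k\<close>, a resilience of at most \<open>d - k\<close>
      would be at most \<open>d / 2 - sqrt d\<close>, against \<open>lower\<close>.\<close>
    moreover have "\<not> local_resilience G (vertex_connected k) + k \<le> d"
    proof
      assume le: "local_resilience G (vertex_connected k) + k \<le> d"
      then have "real (local_resilience G (vertex_connected k) + k) \<le> real d" by (rule of_nat_mono)
      with lower[OF k1 k(2) le] k(1) show False by simp
    qed
    ultimately have "local_resilience G (vertex_connected k) + k = d + 1" using k(2) by linarith
    then have "real (local_resilience G (vertex_connected k) + k) = real (d + 1)" by (rule arg_cong)
    then show "real (local_resilience G (vertex_connected k)) = real d - real k + 1" by simp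
  next
    fix k assume k: "1 \<le> k" "real k < real d / 2 + sqrt (real d)"
    define r where "r = local_resilience G (vertex_connected k)"
    have "sqrt (real d) * 2 \<le> sqrt (real d) * sqrt (real d)"
      using d by (intro mult_left_mono real_le_rsqrt) auto
    then have sq: "sqrt (real d) \<le> real d / 2" by simp
    then have kd: "k \<le> d" using k(2) by simp
    have star: "r \<le> d - k + 1" using local_resilience_le_star[OF G k(1) kd] kd d by (simp add: r_def)
    then have "r + k \<le> d + 1" using kd by linarith
    then have "real (r + k) \<le> real (d + 1)" by (rule of_nat_mono)
    then have star': "real r \<le> real d - real k + 1" by simp
    have "real d / 2 - sqrt (real d) < real r"
    proof (rule ccontr)
      assume le: "\<not> ?thesis"
      \<comment> \<open>For smaller \<open>k\<close>, failure of the lower bound itself supplies the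
        condition \<open>r + k \<le> d\<close> of \<open>lower\<close>.\<close>
      then have "real (r + k) \<le> real d" using k(2) by simp
      then have "r + k \<le> d" by (simp only: of_nat_le_iff)
      then show False using lower[OF k(1) kd] le by (simp add: r_def)
    qed
    \<comment> \<open>The Stiebitz bound \<open>d / 2 + 1\<close> is stronger, since
      \<open>d * ln d\<close> is at least 1.\<close>
    moreover have "real r \<le> real d / 2 + 4 * sqrt (real d * ln (real d))"
    proof -
      have "3 \<le> real d" using d by simp
      then have "exp 1 \<le> real d" using exp_le by linarith
      then have "1 \<le> ln (real d)" using d by (simp add: ln_ge_iff)
      then have "1 * 1 \<le> real d * ln (real d)" using d by (intro mult_mono) auto
      then have "1 \<le> sqrt (real d * ln (real d))" by simp
      moreover have "real r \<le> real d / 2 + 1"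
        unfolding r_def using k kd d by (intro local_resilience_le_half[OF G]) auto
      ultimately show ?thesis by linarith
    qed
    ultimately show "real d / 2 - sqrt (real d) < real (local_resilience G (vertex_connected k)) \<and>
      real (local_resilience G (vertex_connected k))
        \<le> min (real d - real k + 1) (real d / 2 + 4 * sqrt (real d * ln (real d)))"
      using star' by (simp add: r_def)
  }
qed

theorem theorem2:
  shows "\<exists>d0::nat. d0 > 0 \<and> (\<forall>d::nat. d \<ge> d0 \<longrightarrow>
    ((\<lambda>n::nat. measure_pmf.prob (random_regular_graph n d)
       {G. (\<forall>k::nat. real d / 2 + sqrt (real d) \<le> real k \<and> k \<le> d \<longrightarrow>
              real (local_resilience G (vertex_connected k)) = real d - real k + 1) \<and>
           (\<forall>k::nat. 1 \<le> k \<and> real k < real d / 2 + sqrt (real d) \<longrightarrow>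
              real d / 2 - sqrt (real d) < real (local_resilience G (vertex_connected k)) \<and>
              real (local_resilience G (vertex_connected k))
                \<le> min (real d - real k + 1)
                      (real d / 2 + 4 * sqrt (real d * ln (real d))))})
     \<longlongrightarrow> 1) (inf sequentially (principal {n. even (d * n)})))"
proof (intro exI[of _ 400] conjI allI impI)
  fix d :: nat assume d: "400 \<le> d"
  let ?F = "inf sequentially (principal {n. even (d * n)})"
  define Good where "Good = {G :: nat graph. (\<forall>k::nat. real d / 2 + sqrt (real d) \<le> real k \<and> k \<le> d \<longrightarrow>
              real (local_resilience G (vertex_connected k)) = real d - real k + 1) \<and>
           (\<forall>k::nat. 1 \<le> k \<and> real k < real d / 2 + sqrt (real d) \<longrightarrow>
              real d / 2 - sqrt (real d) < real (local_resilience G (vertex_connected k)) \<and>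
              real (local_resilience G (vertex_connected k))
                \<le> min (real d - real k + 1)
                      (real d / 2 + 4 * sqrt (real d * ln (real d))))}"
  \<comment> \<open>The largest possible size of \<open>A \<union> S\<close> in the bounded
    case.\<close>
  define M where "M = 40 * d\<^sup>2 + d"
  define C1 where "C1 = (real M + 1) * (real d * (real M)\<^sup>2 + 1) ^ (M + 1)"
  define C2 where "C2 = 2 * exp (16 * (real d)\<^sup>2) / (1 - 2 * exp (- (3 / 4)))\<^sup>2"
  define n0 where "n0 = 4 * M + 16 * d + 1"
  have bound: "1 - (C1 + C2) / real n \<le> measure_pmf.prob (random_regular_graph n d) Good"
    if n: "n0 \<le> n" and ev: "even (d * n)" for n
  proof -
    let ?R = "regular_graphs n d"
    let ?N = "real (card ?R)"
    have n': "4 * M + 4 * d \<le> n" "16 * d \<le> n" "2 * d < n" "d < n" using n by (auto simp: n0_def)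
    \<comment> \<open>Nonemptiness makes \<open>pmf_of_set\<close> the uniform distribution and
      permits division by \<open>?N\<close>.\<close>
    have ne: "?R \<noteq> {}" using ev n'(3) by (rule regular_graphs_nonempty)
    have finR: "finite ?R" by (rule finite_regular_graphs)
    have N: "0 < ?N" using ne finR by (simp add: card_gt_0_iff)
    have sub: "?R \<subseteq> (?R \<inter> Good) \<union> (dense_small n d M \<union> dense_large n d)"
      using local_resilience_bounds[OF _ d n'(4)] unfolding Good_def M_def by blast
    have "finite (dense_small n d M)" "finite (dense_large n d)"
      by (rule finite_subset[OF _ finR], auto simp: dense_small_def dense_large_def regular_with_arcs_ge_def)+
    then have "card ?R \<le> card ((?R \<inter> Good) \<union> (dense_small n d M \<union> dense_large n d))"
      using sub finR by (intro card_mono) auto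
    also have "\<dots> \<le> card (?R \<inter> Good) + (card (dense_small n d M) + card (dense_large n d))"
      by (meson add_left_mono card_Un_le le_trans)
    finally have "?N \<le> real (card (?R \<inter> Good) + (card (dense_small n d M) + card (dense_large n d)))"
      by (rule of_nat_mono)
    moreover have "real (card (dense_small n d M)) \<le> C1 / real n * ?N"
      unfolding C1_def using d n' by (intro card_dense_small) auto
    moreover have "real (card (dense_large n d)) \<le> C2 / real n * ?N"
      unfolding C2_def using d n' by (intro card_dense_large) auto
    ultimately have "?N \<le> real (card (?R \<inter> Good)) + (C1 / real n * ?N + C2 / real n * ?N)" by simp
    then have "(1 - (C1 + C2) / real n) * ?N \<le> real (card (?R \<inter> Good))"
      by (simp add: add_divide_distrib algebra_simps)
    then have "1 - (C1 + C2) / real n \<le> real (card (?R \<inter> Good)) / ?N"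
      using N by (simp only: pos_le_divide_eq)
    then show ?thesis
      unfolding random_regular_graph_def using ne finR by (simp add: measure_pmf_of_set)
  qed
  have "((\<lambda>n. measure_pmf.prob (random_regular_graph n d) Good) \<longlongrightarrow> 1) ?F"
  proof (rule tendsto_sandwich)
    \<comment> \<open>Along this filter the bound is needed only for large \<open>n\<close> with
      \<open>d * n\<close> even.\<close>
    show "\<forall>\<^sub>F n in ?F. 1 - (C1 + C2) / real n \<le> measure_pmf.prob (random_regular_graph n d) Good"
      unfolding eventually_inf_principal using eventually_ge_at_top[of n0]
      by eventually_elim (use bound in auto)
    show "\<forall>\<^sub>F n in ?F. measure_pmf.prob (random_regular_graph n d) Good \<le> 1"
      by (intro always_eventually allI measure_pmf.prob_le_1)
    have "(\<lambda>n. 1 - (C1 + C2) / real n) \<longlonglongrightarrow> 1 - 0"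
      by (intro tendsto_diff tendsto_const lim_const_over_n)
    then show "((\<lambda>n. 1 - (C1 + C2) / real n) \<longlongrightarrow> 1) ?F"
      by (simp add: tendsto_mono[OF inf_le1])
  qed (rule tendsto_const)
  then show "((\<lambda>n::nat. measure_pmf.prob (random_regular_graph n d)
       {G. (\<forall>k::nat. real d / 2 + sqrt (real d) \<le> real k \<and> k \<le> d \<longrightarrow>
              real (local_resilience G (vertex_connected k)) = real d - real k + 1) \<and>
           (\<forall>k::nat. 1 \<le> k \<and> real k < real d / 2 + sqrt (real d) \<longrightarrow>
              real d / 2 - sqrt (real d) < real (local_resilience G (vertex_connected k)) \<and>
              real (local_resilience G (vertex_connected k))
                \<le> min (real d - real k + 1)
                      (real d / 2 + 4 * sqrt (real d * ln (real d))))})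
     \<longlongrightarrow> 1) ?F"
    unfolding Good_def .
qed simp

end
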